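(* Let $\pi$ and $\mathcal{S}$ satisfy the regularity assumptions (R1)–(R2) of the context, let $\mu>0$, and let $I$, $\beta_1$, $\beta_2$ be the associated constants. Let $\{\gamma_i\}_{i\ge 1}$ be a realisation of an i.i.d. sequence of $\mathrm{Uniform}([0,1])$ random variables and let $\{x_i\}_{i\ge 1}$ be a realisation of an (independent) i.i.d. sequence with marginal density $\pi$. For $d\ge 1$ set $\mathbf{x}^{(d)}=(x_1,\dots,x_d)$ and $$\mathbf{X}^{(d),*}=\mathbf{x}^{(d)}+\frac{\mu}{I\sqrt d}\,\mathbf{Z}^{(d)},\qquad \mathbf{Z}^{(d)}\sim \mathrm{N}(\mathbf 0,\mathbf I_d).$$ Then, for almost all realisations $\{x_i\}_{i\ge1}$ and $\{\gamma_i\}_{i\ge1}$, as $d\to\infty$ the random vector $$\begin{bmatrix} q^{(d)}_\Delta(\mathbf{x}^{(d)},\mathbf{X}^{(d),*})\\ s^{(d)}_\Delta(\mathbf{x}^{(d)},\mathbf{X}^{(d),*})\end{bmatrix}$$ (random through $\mathbf{Z}^{(d)}$ only) converges in distribution to $$\begin{bmatrix} Q^\infty_\Delta\\ S^\infty_\Delta\end{bmatrix}\sim \mathrm{N}\left(-\frac{\mu^2}{2}\begin{bmatrix}1\\-\beta_1\end{bmatrix},\ \mu^2\begin{bmatrix}1&-\beta_1\\-\beta_1&\beta_2^2\end{bmatrix}\right).$$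
   Context: $\pi:\mathbb{R}\to(0,\infty)$ is a probability density on $\mathbb{R}$ with respect to Lebesgue measure and $\mathcal{S}:\mathbb{R}\times[0,1]\to\mathbb{R}$ is a measurable function. Regularity assumptions: (R1) $x\mapsto\log\pi(x)$ is thrice differentiable with bounded second and third derivatives, and $\mathbb{E}[((\log\pi)'(X))^2]<\infty$ for $X\sim\pi$; (R2) the first three derivatives of $(x,\gamma)\mapsto\mathcal{S}(x,\gamma)$ with respect to the first argument exist and are bounded over $\mathbb{R}\times[0,1]$. Constants: $I>0$ is defined by $I^2=\mathbb{E}[((\log\pi)'(X))^2]$ for $X\sim\pi$; and, for independent $X\sim\pi$ and $\Gamma\sim\mathrm{Uniform}([0,1])$, $$\beta_1=\frac{\mathbb{E}[\partial_{xx}\mathcal{S}(X,\Gamma)]}{I^2},\qquad \beta_2=\left\{\frac{\mathbb{E}[(\partial_x\mathcal{S}(X,\Gamma))^2]}{I^2}\right\}^{1/2}.$$ For $\mathbf{x}=(x_1,\dots,x_d)$ set $\pi^{(d)}(\mathbf{x})=\prod_{i=1}^d\pi(x_i)$ and, for a given sequence $\{\gamma_i\}_{i\ge1}\subset[0,1]$, $s^{(d)}(\mathbf{x})=\sum_{i=1}^d\mathcal{S}(x_i,\gamma_i)$. Define $$q^{(d)}_\Delta(\mathbf{x},\mathbf{x}^* )=\log\frac{\pi^{(d)}(\mathbf{x}^* )}{\pi^{(d)}(\mathbf{x})},\qquad s^{(d)}_\Delta(\mathbf{x},\mathbf{x}^* )=s^{(d)}(\mathbf{x}^* )-s^{(d)}(\mathbf{x}).$$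 *)

theory Defs
  imports "HOL-Probability.Probability"
begin

definition dens_law :: "(real \<Rightarrow> real) \<Rightarrow> real measure" where
  "dens_law \<pi> = density lborel (\<lambda>x. ennreal (\<pi> x))"

definition positive_prob_density :: "(real \<Rightarrow> real) \<Rightarrow> bool" where
  "positive_prob_density \<pi> \<longleftrightarrow>
     \<pi> \<in> borel_measurable borel \<and> (\<forall>x. 0 < \<pi> x) \<and> prob_space (dens_law \<pi>)"

(* The uniform law lives on the space {0..1}, not on all of the reals: \<S> is constrained on
   {0..1} only in its second argument, so over uniform_measure lborel {0..1} its x-derivatives
   could be non-measurable, and their integrals would then be 0 by convention. *)
definition unif01 :: "real measure" where
  "unif01 = restrict_space lborel {0..1}"

definition thrice_differentiable :: "(real \<Rightarrow> real) \<Rightarrow> bool" where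
  "thrice_differentiable f \<longleftrightarrow> (\<forall>k<3. \<forall>x. (deriv ^^ k) f differentiable (at x))"

definition dx :: "nat \<Rightarrow> (real \<Rightarrow> real \<Rightarrow> real) \<Rightarrow> real \<Rightarrow> real \<Rightarrow> real" where
  "dx k \<S> x \<gamma> = (deriv ^^ k) (\<lambda>u. \<S> u \<gamma>) x"

definition score :: "(real \<Rightarrow> real) \<Rightarrow> real \<Rightarrow> real" where
  "score \<pi> = deriv (\<lambda>x. ln (\<pi> x))"

definition regular_density :: "(real \<Rightarrow> real) \<Rightarrow> bool" where
  "regular_density \<pi> \<longleftrightarrow>
     thrice_differentiable (\<lambda>x. ln (\<pi> x)) \<and>
     bounded (range ((deriv ^^ 2) (\<lambda>x. ln (\<pi> x)))) \<and>
     bounded (range ((deriv ^^ 3) (\<lambda>x. ln (\<pi> x)))) \<and>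
     integrable (dens_law \<pi>) (\<lambda>x. (score \<pi> x)\<^sup>2)"

definition regular_S :: "(real \<Rightarrow> real \<Rightarrow> real) \<Rightarrow> bool" where
  "regular_S \<S> \<longleftrightarrow>
     (\<forall>\<gamma>\<in>{0..1}. thrice_differentiable (\<lambda>x. \<S> x \<gamma>)) \<and>
     (\<forall>k\<in>{1..3}. bounded ((\<lambda>(x, \<gamma>). dx k \<S> x \<gamma>) ` (UNIV \<times> {0..1})))"

definition info :: "(real \<Rightarrow> real) \<Rightarrow> real" where
  "info \<pi> = sqrt (\<integral>x. (score \<pi> x)\<^sup>2 \<partial>dens_law \<pi>)"

definition beta1 :: "(real \<Rightarrow> real) \<Rightarrow> (real \<Rightarrow> real \<Rightarrow> real) \<Rightarrow> real" where
  "beta1 \<pi> \<S> =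
     (\<integral>(x, \<gamma>). dx 2 \<S> x \<gamma> \<partial>(dens_law \<pi> \<Otimes>\<^sub>M unif01)) / (info \<pi>)\<^sup>2"

definition beta2 :: "(real \<Rightarrow> real) \<Rightarrow> (real \<Rightarrow> real \<Rightarrow> real) \<Rightarrow> real" where
  "beta2 \<pi> \<S> =
     sqrt ((\<integral>(x, \<gamma>). (dx 1 \<S> x \<gamma>)\<^sup>2 \<partial>(dens_law \<pi> \<Otimes>\<^sub>M unif01)) / (info \<pi>)\<^sup>2)"

(* A vector in R^d is a function on nat of which only the coordinates 0, ..., d-1 matter. *)

definition prod_density :: "(real \<Rightarrow> real) \<Rightarrow> nat \<Rightarrow> (nat \<Rightarrow> real) \<Rightarrow> real" where
  "prod_density \<pi> d x = (\<Prod>i<d. \<pi> (x i))"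

definition sum_S :: "(real \<Rightarrow> real \<Rightarrow> real) \<Rightarrow> (nat \<Rightarrow> real) \<Rightarrow> nat \<Rightarrow> (nat \<Rightarrow> real) \<Rightarrow> real" where
  "sum_S \<S> \<gamma> d x = (\<Sum>i<d. \<S> (x i) (\<gamma> i))"

definition q_Delta :: "(real \<Rightarrow> real) \<Rightarrow> nat \<Rightarrow> (nat \<Rightarrow> real) \<Rightarrow> (nat \<Rightarrow> real) \<Rightarrow> real" where
  "q_Delta \<pi> d x y = ln (prod_density \<pi> d y / prod_density \<pi> d x)"

definition s_Delta ::
  "(real \<Rightarrow> real \<Rightarrow> real) \<Rightarrow> (nat \<Rightarrow> real) \<Rightarrow> nat \<Rightarrow> (nat \<Rightarrow> real) \<Rightarrow> (nat \<Rightarrow> real) \<Rightarrow> real" where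
  "s_Delta \<S> \<gamma> d x y = sum_S \<S> \<gamma> d y - sum_S \<S> \<gamma> d x"

definition std_normal_d :: "nat \<Rightarrow> (nat \<Rightarrow> real) measure" where
  "std_normal_d d = (\<Pi>\<^sub>M i\<in>{..<d}. std_normal_distribution)"

definition proposal ::
  "(real \<Rightarrow> real) \<Rightarrow> real \<Rightarrow> nat \<Rightarrow> (nat \<Rightarrow> real) \<Rightarrow> (nat \<Rightarrow> real) \<Rightarrow> (nat \<Rightarrow> real)" where
  "proposal \<pi> \<mu> d x z = (\<lambda>i. x i + \<mu> / (info \<pi> * sqrt (real d)) * z i)"

(* The law of m + A Z with Z standard normal and A A^T = V; V may be singular. *)
definition multivariate_normal ::
  "real ^ 'n \<Rightarrow> real ^ 'n ^ 'n \<Rightarrow> (real ^ 'n) measure \<Rightarrow> bool" where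
  "multivariate_normal m V L \<longleftrightarrow>
     (\<exists>A :: real ^ 'n ^ 'n. A ** transpose A = V \<and>
        L = distr (\<Pi>\<^sub>M i\<in>(UNIV :: 'n set). std_normal_distribution) borel
              (\<lambda>z. m + A *v (\<chi> i. z i)))"

(* The random vectors Y n may live on different probability spaces P n. *)
definition converges_in_distribution ::
  "(nat \<Rightarrow> 'w measure) \<Rightarrow> (nat \<Rightarrow> 'w \<Rightarrow> 'b :: topological_space) \<Rightarrow> 'b measure \<Rightarrow> bool" where
  "converges_in_distribution P Y L \<longleftrightarrow>
     (\<forall>n. Y n \<in> borel_measurable (P n)) \<and>
     (\<forall>f :: 'b \<Rightarrow> real. continuous_on UNIV f \<and> bounded (range f) \<longrightarrow>
        (\<lambda>n. \<integral>\<omega>. f (Y n \<omega>) \<partial>P n) \<longlonglongrightarrow> (\<integral>y. f y \<partial>L))"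

end

theory Submission
  imports Defs
begin

text \<open>
  The step size is of order \<open>1 / sqrt d\<close>, so both coordinates of the random vector are governed by
  a second-order Taylor expansion. Write \<open>\<tau> = \<mu> / I\<close> and \<open>l = ln \<pi>\<close>. Up to an error that vanishes
  in mean,
  \<open>q = (\<tau> / sqrt d) * (\<Sum>i<d. l' (x i) * z i) + (\<tau>\<^sup>2 / 2) * (\<Sum>i<d. l'' (x i)) / d\<close>,
  and likewise for \<open>s\<close> with \<open>\<S>\<close> in place of \<open>l\<close>. The cubic remainder is negligible because third
  derivatives are bounded, and \<open>(z i)\<^sup>2\<close> can be replaced by its mean \<open>1\<close> because the fluctuations are
  uncorrelated (\<open>quadratic_expansion_of_sum\<close>).

  What is left depends on the realisation through averages of functions of the independent,
  identically distributed pairs \<open>(x i, \<gamma> i)\<close> only. The averages of the second derivatives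
  determine the limiting means; those of squares and products of first derivatives determine the
  covariance matrix of the linear terms. All of them converge almost surely by a strong law for
  square-integrable terms (\<open>strong_law_pairs\<close>). For \<open>(l')\<^sup>2\<close> this requires a fourth moment of the
  score \<open>l'\<close>, which comes from integration by parts against \<open>\<pi>\<close>, since \<open>l''\<close> is bounded
  (\<open>integrable_score_pow4\<close>). The same integration by parts (\<open>stein_identity\<close>) gives
  \<open>E l'' = - I\<^sup>2\<close> and \<open>E (l' * \<partial>\<^sub>x \<S>) = - E \<partial>\<^sub>x\<^sub>x \<S>\<close>, which is why one constant \<open>\<beta>\<^sub>1\<close> governs both a
  mean and a covariance.

  Given the realisation, the two linear terms are linear forms in independent standard normals.
  Their joint law is determined by their covariance matrix: rotations of the plane, which preserve
  the standard normal law, reduce them to a triangular form in two standard normals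
  (\<open>distr_linear_pair_std_normal\<close>). The triangular form is continuous in the covariances, so the
  linear terms converge to the normal law with the limiting covariance matrix
  (\<open>linear_pair_converges_in_distribution\<close>). An error that vanishes in mean does not change the
  limit (\<open>converges_in_distribution_perturb\<close>). The limit matrix is positive semidefinite
  because the covariance matrices for finite \<open>d\<close> are.
\<close>

section \<open>Uncorrelated sums and errors that vanish in mean\<close>

lemma (in prob_space) indep_vars_imp_indep_var:
  assumes ind: "indep_vars M' X I" and ij: "i \<in> I" "j \<in> I" "i \<noteq> j"
  shows "indep_var (M' i) (X i) (M' j) (X j)"
proof -
  have "indep_var (PiM {i} M') (\<lambda>\<omega>. restrict (\<lambda>i. X i \<omega>) {i}) (PiM {j} M') (\<lambda>\<omega>. restrict (\<lambda>i. X i \<omega>) {j})"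
    using ij by (intro indep_var_restrict[OF ind]) auto
  then have "indep_var (M' i) ((\<lambda>z. z i) \<circ> (\<lambda>\<omega>. restrict (\<lambda>i. X i \<omega>) {i}))
      (M' j) ((\<lambda>z. z j) \<circ> (\<lambda>\<omega>. restrict (\<lambda>i. X i \<omega>) {j}))"
    by (rule indep_var_compose) (auto intro: measurable_component_singleton)
  then show ?thesis by (simp add: comp_def)
qed

lemma second_moment_sum_uncorrelated:
  fixes Y :: "'i \<Rightarrow> 'a \<Rightarrow> real"
  assumes "finite I"
    and meas: "\<And>i. i \<in> I \<Longrightarrow> Y i \<in> borel_measurable M"
    and sq: "\<And>i. i \<in> I \<Longrightarrow> integrable M (\<lambda>\<omega>. (Y i \<omega>)\<^sup>2)"
    and uncorr: "\<And>i j. i \<in> I \<Longrightarrow> j \<in> I \<Longrightarrow> i \<noteq> j \<Longrightarrow> (\<integral>\<omega>. Y i \<omega> * Y j \<omega> \<partial>M) = 0"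
  shows "integrable M (\<lambda>\<omega>. (\<Sum>i\<in>I. Y i \<omega>)\<^sup>2)"
    and "(\<integral>\<omega>. (\<Sum>i\<in>I. Y i \<omega>)\<^sup>2 \<partial>M) = (\<Sum>i\<in>I. \<integral>\<omega>. (Y i \<omega>)\<^sup>2 \<partial>M)"
proof -
  have int: "integrable M (\<lambda>\<omega>. Y i \<omega> * Y j \<omega>)" if "i \<in> I" "j \<in> I" for i j
  proof (rule Bochner_Integration.integrable_bound)
    show "integrable M (\<lambda>\<omega>. (Y i \<omega>)\<^sup>2 + (Y j \<omega>)\<^sup>2)"
      using sq that by simp
    have "\<bar>a * b\<bar> \<le> a\<^sup>2 + b\<^sup>2" for a b :: real
    proof -
      have "2 * (\<bar>a\<bar> * \<bar>b\<bar>) \<le> a\<^sup>2 + b\<^sup>2" "0 \<le> \<bar>a\<bar> * \<bar>b\<bar>"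
        using sum_squares_bound[of "\<bar>a\<bar>" "\<bar>b\<bar>"] by auto
      then show ?thesis unfolding abs_mult by linarith
    qed
    then show "AE \<omega> in M. norm (Y i \<omega> * Y j \<omega>) \<le> norm ((Y i \<omega>)\<^sup>2 + (Y j \<omega>)\<^sup>2)"
      by (auto intro!: AE_I2)
  qed (use meas that in measurable)
  have eq: "(\<Sum>i\<in>I. Y i \<omega>)\<^sup>2 = (\<Sum>i\<in>I. \<Sum>j\<in>I. Y i \<omega> * Y j \<omega>)" for \<omega>
    by (simp add: power2_eq_square sum_product)
  show "integrable M (\<lambda>\<omega>. (\<Sum>i\<in>I. Y i \<omega>)\<^sup>2)"
    unfolding eq by (intro Bochner_Integration.integrable_sum int)
  have "(\<integral>\<omega>. (\<Sum>i\<in>I. Y i \<omega>)\<^sup>2 \<partial>M) = (\<Sum>i\<in>I. \<Sum>j\<in>I. \<integral>\<omega>. Y i \<omega> * Y j \<omega> \<partial>M)"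
    unfolding eq by (simp add: int Bochner_Integration.integral_sum)
  also have "\<dots> = (\<Sum>i\<in>I. \<Sum>j\<in>I. if j = i then \<integral>\<omega>. (Y i \<omega>)\<^sup>2 \<partial>M else 0)"
    using uncorr by (intro sum.cong) (auto simp: power2_eq_square)
  also have "\<dots> = (\<Sum>i\<in>I. \<integral>\<omega>. (Y i \<omega>)\<^sup>2 \<partial>M)"
    using \<open>finite I\<close> by (intro sum.cong) auto
  finally show "(\<integral>\<omega>. (\<Sum>i\<in>I. Y i \<omega>)\<^sup>2 \<partial>M) = (\<Sum>i\<in>I. \<integral>\<omega>. (Y i \<omega>)\<^sup>2 \<partial>M)" .
qed

text \<open>
  Slutsky's theorem for an error that vanishes in mean. Convergence of \<open>U\<close> already makes it tight,
  and on a large ball the test function is uniformly continuous; both facts enter through one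
  pointwise inequality, in which a continuous cut-off \<open>c\<close> is integrated along with the error.
\<close>

lemma converges_in_distribution_perturb:
  fixes U V :: "nat \<Rightarrow> 'w \<Rightarrow> 'b :: euclidean_space"
  assumes P: "\<And>d. prob_space (P d)"
    and U: "converges_in_distribution P U L"
    and L: "prob_space L" and sets_L: "sets L = sets borel"
    and V: "\<And>d. V d \<in> borel_measurable (P d)"
    and int: "\<And>d. integrable (P d) (\<lambda>\<omega>. norm (V d \<omega> - U d \<omega>))"
    and lim: "(\<lambda>d. \<integral>\<omega>. norm (V d \<omega> - U d \<omega>) \<partial>P d) \<longlonglongrightarrow> 0"
  shows "converges_in_distribution P V L"
  unfolding converges_in_distribution_def
proof (intro conjI allI impI V)
  interpret L: prob_space L by fact
  have Um: "U d \<in> borel_measurable (P d)" for d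
    using U by (simp add: converges_in_distribution_def)
  have Ulim: "(\<lambda>d. \<integral>\<omega>. g (U d \<omega>) \<partial>P d) \<longlonglongrightarrow> (\<integral>y. g y \<partial>L)"
    if "continuous_on UNIV g" "bounded (range g)" for g :: "'b \<Rightarrow> real"
    using U that by (simp add: converges_in_distribution_def)
  fix f :: "'b \<Rightarrow> real"
  assume f: "continuous_on UNIV f \<and> bounded (range f)"
  then have fm [measurable]: "f \<in> borel_measurable borel"
    by (auto intro: borel_measurable_continuous_onI)
  from f obtain B where B: "\<And>y. \<bar>f y\<bar> \<le> B" and "B > 0"
    by (metis bounded_pos real_norm_def rangeI)
  define c :: "nat \<Rightarrow> 'b \<Rightarrow> real" where "c n y = min 1 (max 0 (norm y - n))" for n y
  have c: "continuous_on UNIV (c n)" "bounded (range (c n))" for n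
    unfolding c_def by (auto intro!: continuous_intros boundedI[of _ 1])
  have cm [measurable]: "c n \<in> borel_measurable borel" for n
    using c by (auto intro: borel_measurable_continuous_onI)
  have c01: "0 \<le> c n y" "c n y \<le> 1" for n y by (auto simp: c_def)
  have "(\<lambda>n. \<integral>y. c n y \<partial>L) \<longlonglongrightarrow> (\<integral>y. 0 \<partial>L)"
  proof (rule integral_dominated_convergence)
    show "AE y in L. (\<lambda>n. c n y) \<longlonglongrightarrow> 0"
    proof (intro AE_I2 tendsto_eventually)
      fix y :: 'b
      obtain N where "norm y \<le> real N" using real_arch_simple by blast
      then show "\<forall>\<^sub>F n in sequentially. c n y = 0"
        by (intro eventually_sequentiallyI[of N]) (auto simp: c_def)
    qed
    show "AE y in L. norm (c n y) \<le> 1" for n using c01 by auto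
    show "c n \<in> borel_measurable L" for n by (simp add: measurable_cong_sets[OF sets_L refl])
  qed auto
  then have clim: "(\<lambda>n. \<integral>y. c n y \<partial>L) \<longlonglongrightarrow> 0" by simp
  have diff: "(\<lambda>d. \<integral>\<omega>. \<bar>f (V d \<omega>) - f (U d \<omega>)\<bar> \<partial>P d) \<longlonglongrightarrow> 0"
  proof (rule LIMSEQ_I)
    fix e :: real assume "e > 0"
    from clim have "\<forall>\<^sub>F n in sequentially. (\<integral>y. c n y \<partial>L) < e / (8 * B)"
      by (rule order_tendstoD(2)) (use \<open>e > 0\<close> \<open>B > 0\<close> in auto)
    then obtain n where n: "(\<integral>y. c n y \<partial>L) < e / (8 * B)"
      by (auto simp: eventually_sequentially)
    have "uniformly_continuous_on (cball 0 (real n + 2)) f"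
      using f by (intro compact_uniformly_continuous) (auto intro: continuous_on_subset)
    with \<open>e > 0\<close> obtain \<delta>' where \<delta>': "\<delta>' > 0"
      "\<And>y z. y \<in> cball 0 (real n + 2) \<Longrightarrow> z \<in> cball 0 (real n + 2) \<Longrightarrow> dist z y < \<delta>' \<Longrightarrow> dist (f z) (f y) < e / 4"
      unfolding uniformly_continuous_on_def by (metis zero_less_divide_iff zero_less_numeral)
    define \<delta> where "\<delta> = min 1 \<delta>'"
    have "\<delta> > 0" using \<delta>' by (simp add: \<delta>_def)
    have pw: "\<bar>f v - f u\<bar> \<le> e / 4 + 2 * B * c n u + 2 * B / \<delta> * norm (v - u)" for u v
    proof -
      have b2: "\<bar>f v - f u\<bar> \<le> 2 * B" using B[of u] B[of v] by linarith
      have nn: "0 \<le> 2 * B * c n u" "0 \<le> 2 * B / \<delta> * norm (v - u)"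
        using c01 \<open>B > 0\<close> \<open>\<delta> > 0\<close> by auto
      consider "norm u > real n + 1" | "norm (v - u) \<ge> \<delta>" | "norm u \<le> real n + 1" "norm (v - u) < \<delta>"
        by linarith
      then show ?thesis
      proof cases
        case 1
        then have "c n u = 1" by (simp add: c_def)
        then show ?thesis using b2 nn \<open>e > 0\<close> by simp
      next
        case 2
        then have "2 * B \<le> 2 * B / \<delta> * norm (v - u)"
          using \<open>B > 0\<close> \<open>\<delta> > 0\<close> by (simp add: field_simps)
        then show ?thesis using b2 nn \<open>e > 0\<close> by linarith
      next
        case 3
        have "norm v \<le> norm u + norm (v - u)" by (metis add.commute norm_triangle_sub)
        then have "u \<in> cball 0 (real n + 2)" "v \<in> cball 0 (real n + 2)" "dist v u < \<delta>'"
          using 3 by (auto simp: \<delta>_def dist_norm)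
        then have "dist (f v) (f u) < e / 4" using \<delta>'(2) by blast
        then show ?thesis using nn by (simp add: dist_real_def)
      qed
    qed
    let ?R = "\<lambda>d. \<integral>\<omega>. norm (V d \<omega> - U d \<omega>) \<partial>P d"
    have le: "(\<integral>\<omega>. \<bar>f (V d \<omega>) - f (U d \<omega>)\<bar> \<partial>P d)
        \<le> e / 4 + 2 * B * (\<integral>\<omega>. c n (U d \<omega>) \<partial>P d) + 2 * B / \<delta> * ?R d" for d
    proof -
      interpret Pd: prob_space "P d" by (rule P)
      note [measurable] = Um[of d] V[of d]
      have ic: "integrable (P d) (\<lambda>\<omega>. c n (U d \<omega>))"
        using c01 by (intro Pd.integrable_const_bound[where B=1]) auto
      have "(\<integral>\<omega>. \<bar>f (V d \<omega>) - f (U d \<omega>)\<bar> \<partial>P d)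
          \<le> (\<integral>\<omega>. e / 4 + 2 * B * c n (U d \<omega>) + 2 * B / \<delta> * norm (V d \<omega> - U d \<omega>) \<partial>P d)"
      proof (rule integral_mono)
        show "integrable (P d) (\<lambda>\<omega>. \<bar>f (V d \<omega>) - f (U d \<omega>)\<bar>)"
        proof (rule Pd.integrable_const_bound[where B="2 * B"])
          have "\<bar>f y - f z\<bar> \<le> 2 * B" for y z using B[of y] B[of z] by linarith
          then show "AE \<omega> in P d. norm \<bar>f (V d \<omega>) - f (U d \<omega>)\<bar> \<le> 2 * B" by auto
        qed simp
      qed (use ic int pw in auto)
      also have "\<dots> = e / 4 + 2 * B * (\<integral>\<omega>. c n (U d \<omega>) \<partial>P d) + 2 * B / \<delta> * ?R d"
        using ic int by (simp add: Pd.prob_space)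
      finally show ?thesis .
    qed
    have "(\<lambda>d. e / 4 + 2 * B * (\<integral>\<omega>. c n (U d \<omega>) \<partial>P d) + 2 * B / \<delta> * ?R d)
        \<longlonglongrightarrow> e / 4 + 2 * B * (\<integral>y. c n y \<partial>L) + 2 * B / \<delta> * 0"
      by (intro tendsto_intros Ulim c lim)
    moreover have "e / 4 + 2 * B * (\<integral>y. c n y \<partial>L) + 2 * B / \<delta> * 0 < e"
      using n \<open>B > 0\<close> \<open>e > 0\<close> by (simp add: field_simps)
    ultimately have "\<forall>\<^sub>F d in sequentially.
        e / 4 + 2 * B * (\<integral>\<omega>. c n (U d \<omega>) \<partial>P d) + 2 * B / \<delta> * ?R d < e"
      by (rule order_tendstoD)
    then obtain N where N: "\<And>d. d \<ge> N \<Longrightarrow>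
        e / 4 + 2 * B * (\<integral>\<omega>. c n (U d \<omega>) \<partial>P d) + 2 * B / \<delta> * ?R d < e"
      by (auto simp: eventually_sequentially)
    have "norm ((\<integral>\<omega>. \<bar>f (V d \<omega>) - f (U d \<omega>)\<bar> \<partial>P d) - 0) < e" if "d \<ge> N" for d
      using le[of d] N[OF that] by (simp add: integral_nonneg_AE)
    then show "\<exists>N. \<forall>d\<ge>N. norm ((\<integral>\<omega>. \<bar>f (V d \<omega>) - f (U d \<omega>)\<bar> \<partial>P d) - 0) < e"
      by blast
  qed
  have "(\<lambda>d. (\<integral>\<omega>. f (V d \<omega>) \<partial>P d) - (\<integral>\<omega>. f (U d \<omega>) \<partial>P d)) \<longlonglongrightarrow> 0"
  proof (rule Lim_null_comparison[OF _ diff], rule always_eventually, rule allI)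
    fix d
    interpret Pd: prob_space "P d" by (rule P)
    note [measurable] = Um[of d] V[of d]
    have "integrable (P d) (\<lambda>\<omega>. f (V d \<omega>))" "integrable (P d) (\<lambda>\<omega>. f (U d \<omega>))"
      using B by (auto intro!: Pd.integrable_const_bound[where B=B])
    then show "norm ((\<integral>\<omega>. f (V d \<omega>) \<partial>P d) - (\<integral>\<omega>. f (U d \<omega>) \<partial>P d))
        \<le> (\<integral>\<omega>. \<bar>f (V d \<omega>) - f (U d \<omega>)\<bar> \<partial>P d)"
      by (simp flip: Bochner_Integration.integral_diff)
  qed
  from tendsto_add[OF this Ulim[of f]] f
  show "(\<lambda>d. \<integral>\<omega>. f (V d \<omega>) \<partial>P d) \<longlonglongrightarrow> (\<integral>y. f y \<partial>L)" by simp
qed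

section \<open>Linear forms in independent standard normals\<close>

lemma prob_space_std_normal: "prob_space std_normal_distribution"
  by (rule prob_space_normal_density) simp

text \<open>
  Integrating out one coordinate at a time, a rotation with \<open>c \<noteq> 0\<close> is two affine substitutions,
  whose Jacobians \<open>c\<close> and \<open>1 / c\<close> cancel; a quarter turn is an exchange of the coordinates.
\<close>

lemma lborel_rotation:
  fixes h :: "real \<times> real \<Rightarrow> ennreal"
  assumes h [measurable]: "h \<in> borel_measurable (borel \<Otimes>\<^sub>M borel)" and cs: "c\<^sup>2 + s\<^sup>2 = 1"
  shows "(\<integral>\<^sup>+x. \<integral>\<^sup>+w. h (c * x - s * w, s * x + c * w) \<partial>lborel \<partial>lborel)
       = (\<integral>\<^sup>+x. \<integral>\<^sup>+w. h (x, w) \<partial>lborel \<partial>lborel)"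
proof (cases "c = 0")
  case False
  have eq: "s * ((u + s * w) / c) + c * w = (s * u + w) / c" for u w
  proof -
    have "s * (u + s * w) + c * c * w = s * u + (c\<^sup>2 + s\<^sup>2) * w"
      by (simp add: algebra_simps power2_eq_square)
    then show ?thesis using False cs by (simp add: field_simps)
  qed
  have inner: "(\<integral>\<^sup>+u. h (u, (s * u + w) / c) \<partial>lborel)
      = \<bar>c\<bar> * (\<integral>\<^sup>+x. h (c * x - s * w, s * x + c * w) \<partial>lborel)" for w
  proof -
    have "(s * (- (s * w) + c * x) + w) / c = s * x + c * w" for x
      using eq[of "- (s * w) + c * x" w] False by simp
    then show ?thesis
      by (subst nn_integral_real_affine[where c=c and t="- (s * w)"]) (use False in \<open>auto simp: algebra_simps\<close>)
  qed
  have outer: "(\<integral>\<^sup>+w. h (u, w) \<partial>lborel)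
      = \<bar>1 / c\<bar> * (\<integral>\<^sup>+w. h (u, (s * u + w) / c) \<partial>lborel)" for u
    by (subst nn_integral_real_affine[where c="1 / c" and t="s * u / c"])
       (use False in \<open>auto simp: add_divide_distrib\<close>)
  have "(\<integral>\<^sup>+u. \<integral>\<^sup>+w. h (u, w) \<partial>lborel \<partial>lborel)
      = \<bar>1 / c\<bar> * (\<integral>\<^sup>+u. \<integral>\<^sup>+w. h (u, (s * u + w) / c) \<partial>lborel \<partial>lborel)"
    unfolding outer by (rule nn_integral_cmult) simp
  also have "(\<integral>\<^sup>+u. \<integral>\<^sup>+w. h (u, (s * u + w) / c) \<partial>lborel \<partial>lborel)
      = (\<integral>\<^sup>+w. \<integral>\<^sup>+u. h (u, (s * u + w) / c) \<partial>lborel \<partial>lborel)"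
    by (rule lborel_pair.Fubini'[symmetric]) simp
  also have "\<dots> = \<bar>c\<bar> * (\<integral>\<^sup>+w. \<integral>\<^sup>+x. h (c * x - s * w, s * x + c * w) \<partial>lborel \<partial>lborel)"
    unfolding inner by (rule nn_integral_cmult) simp
  also have "(\<integral>\<^sup>+w. \<integral>\<^sup>+x. h (c * x - s * w, s * x + c * w) \<partial>lborel \<partial>lborel)
      = (\<integral>\<^sup>+x. \<integral>\<^sup>+w. h (c * x - s * w, s * x + c * w) \<partial>lborel \<partial>lborel)"
    by (rule lborel_pair.Fubini') simp
  finally show ?thesis
    using False by (simp add: mult.assoc[symmetric] ennreal_mult[symmetric])
next
  case True
  then have "s \<noteq> 0" and s: "\<bar>s\<bar> = 1" using cs by (auto simp: abs_square_eq_1)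
  have "(\<integral>\<^sup>+x. \<integral>\<^sup>+w. h (x, w) \<partial>lborel \<partial>lborel) = (\<integral>\<^sup>+x. \<integral>\<^sup>+w. h (x, s * w) \<partial>lborel \<partial>lborel)"
    by (subst nn_integral_real_affine[where c=s and t=0]) (use \<open>s \<noteq> 0\<close> s in auto)
  also have "\<dots> = (\<integral>\<^sup>+w. \<integral>\<^sup>+x. h (x, s * w) \<partial>lborel \<partial>lborel)"
    by (rule lborel_pair.Fubini'[symmetric]) simp
  also have "\<dots> = (\<integral>\<^sup>+w. \<integral>\<^sup>+x. h (- s * x, s * w) \<partial>lborel \<partial>lborel)"
    by (subst nn_integral_real_affine[where c="- s" and t=0]) (use \<open>s \<noteq> 0\<close> s in auto)
  finally show ?thesis using True by simp
qed

text \<open>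
  The standard normal density on the plane depends on the radius only, so it inherits the rotation
  invariance of Lebesgue measure.
\<close>

lemma std_normal_rotation:
  fixes g :: "real \<times> real \<Rightarrow> ennreal"
  assumes g [measurable]: "g \<in> borel_measurable (borel \<Otimes>\<^sub>M borel)" and cs: "c\<^sup>2 + s\<^sup>2 = 1"
  shows "(\<integral>\<^sup>+x. \<integral>\<^sup>+w. g (x, w) \<partial>std_normal_distribution \<partial>std_normal_distribution)
       = (\<integral>\<^sup>+x. \<integral>\<^sup>+w. g (c * x - s * w, s * x + c * w) \<partial>std_normal_distribution \<partial>std_normal_distribution)"
proof -
  let ?\<phi> = std_normal_density
  interpret N: prob_space std_normal_distribution by (rule prob_space_std_normal)
  have iter: "(\<integral>\<^sup>+x. \<integral>\<^sup>+w. k (x, w) \<partial>std_normal_distribution \<partial>std_normal_distribution)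
      = (\<integral>\<^sup>+x. \<integral>\<^sup>+w. ennreal (?\<phi> x * ?\<phi> w) * k (x, w) \<partial>lborel \<partial>lborel)"
    if [measurable]: "k \<in> borel_measurable (borel \<Otimes>\<^sub>M borel)" for k :: "real \<times> real \<Rightarrow> ennreal"
  proof -
    have "(\<lambda>x. \<integral>\<^sup>+w. k (x, w) \<partial>std_normal_distribution) \<in> borel_measurable borel"
      by measurable
    then show ?thesis
      by (simp add: nn_integral_density nn_integral_cmult[symmetric] ennreal_mult normal_density_nonneg mult.assoc)
  qed
  have rad: "?\<phi> (c * x - s * w) * ?\<phi> (s * x + c * w) = ?\<phi> x * ?\<phi> w" for x w
  proof -
    have "(c * x - s * w)\<^sup>2 + (s * x + c * w)\<^sup>2 = (c\<^sup>2 + s\<^sup>2) * (x\<^sup>2 + w\<^sup>2)"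
      by (simp add: power2_eq_square algebra_simps)
    then have "exp (- (c * x - s * w)\<^sup>2 / 2) * exp (- (s * x + c * w)\<^sup>2 / 2) = exp (- x\<^sup>2 / 2) * exp (- w\<^sup>2 / 2)"
      using cs by (simp add: exp_add[symmetric] add_divide_distrib[symmetric])
    then show ?thesis by (simp add: std_normal_density_def)
  qed
  define h where "h z = ennreal (?\<phi> (fst z) * ?\<phi> (snd z)) * g z" for z
  have "h \<in> borel_measurable (borel \<Otimes>\<^sub>M borel)" unfolding h_def by measurable
  from lborel_rotation[OF this cs] show ?thesis
    using iter[OF g] iter[of "\<lambda>z. g (c * fst z - s * snd z, s * fst z + c * snd z)"]
    by (simp add: h_def rad)
qed

lemma plane_rotation_onto_axis:
  fixes a p :: real
  obtains c s where "c\<^sup>2 + s\<^sup>2 = 1" "a * c + p * s = 0" "p * c - a * s = sqrt (p\<^sup>2 + a\<^sup>2)"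
proof (cases "p\<^sup>2 + a\<^sup>2 = 0")
  case True
  then have "p = 0" "a = 0" by (auto simp: sum_power2_eq_zero_iff)
  then show ?thesis using that[of 1 0] by simp
next
  case False
  define n where "n = sqrt (p\<^sup>2 + a\<^sup>2)"
  have n: "n \<noteq> 0" "n\<^sup>2 = p\<^sup>2 + a\<^sup>2" using False by (auto simp: n_def)
  show ?thesis
  proof (rule that[of "p / n" "- a / n"])
    show "(p / n)\<^sup>2 + (- a / n)\<^sup>2 = 1"
      unfolding power_divide power2_minus add_divide_distrib[symmetric] n(2)[symmetric] using n(1) by simp
    show "a * (p / n) + p * (- a / n) = 0" by simp
    have "p * (p / n) - a * (- a / n) = n\<^sup>2 / n" unfolding n(2) by (simp add: power2_eq_square add_divide_distrib)
    also have "\<dots> = n" using n(1) by (simp add: power2_eq_square)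
    finally show "p * (p / n) - a * (- a / n) = sqrt (p\<^sup>2 + a\<^sup>2)" by (simp only: n_def)
  qed
qed

text \<open>
  A pair of linear forms in independent standard normals has the law of a triangular pair
  \<open>(p x, q x + r y)\<close>. Coordinates are absorbed one at a time: a rotation of the new coordinate
  against \<open>x\<close> frees the first form of it, and a rotation of what is left over against \<open>y\<close>
  restores the triangular shape.
\<close>

lemma nn_integral_linear_pair:
  fixes a b :: "'i \<Rightarrow> real"
  assumes "finite I"
  shows "\<exists>p q r. 0 \<le> p \<and> 0 \<le> r \<and> p\<^sup>2 = (\<Sum>i\<in>I. (a i)\<^sup>2) \<and> p * q = (\<Sum>i\<in>I. a i * b i)
    \<and> q\<^sup>2 + r\<^sup>2 = (\<Sum>i\<in>I. (b i)\<^sup>2)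
    \<and> (\<forall>f :: real \<times> real \<Rightarrow> ennreal. f \<in> borel_measurable (borel \<Otimes>\<^sub>M borel) \<longrightarrow>
        (\<integral>\<^sup>+z. f (\<Sum>i\<in>I. a i * z i, \<Sum>i\<in>I. b i * z i) \<partial>(\<Pi>\<^sub>M i\<in>I. std_normal_distribution))
      = (\<integral>\<^sup>+x. \<integral>\<^sup>+y. f (p * x, q * x + r * y) \<partial>std_normal_distribution \<partial>std_normal_distribution))"
  using assms
proof (induction I)
  let ?N = "std_normal_distribution"
  interpret N: prob_space ?N by (rule prob_space_std_normal)
  have N1: "emeasure ?N UNIV = 1" using N.emeasure_space_1 by simp
  interpret NN: pair_sigma_finite ?N ?N ..
  interpret product_sigma_finite "\<lambda>_::'i. ?N" ..
  {
    case empty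
    interpret E: prob_space "\<Pi>\<^sub>M i\<in>{}. ?N"
      by (rule prob_space_PiM) (rule prob_space_std_normal)
    show ?case
      by (rule exI[of _ 0], rule exI[of _ 0], rule exI[of _ 0])
         (simp add: E.emeasure_space_1 N1)
  next
    case (insert i I)
    then obtain p q r where pqr: "0 \<le> p" "0 \<le> r" "p\<^sup>2 = (\<Sum>i\<in>I. (a i)\<^sup>2)" "p * q = (\<Sum>i\<in>I. a i * b i)"
      "q\<^sup>2 + r\<^sup>2 = (\<Sum>i\<in>I. (b i)\<^sup>2)"
      and IH: "\<And>f :: real \<times> real \<Rightarrow> ennreal. f \<in> borel_measurable (borel \<Otimes>\<^sub>M borel) \<Longrightarrow>
        (\<integral>\<^sup>+z. f (\<Sum>i\<in>I. a i * z i, \<Sum>i\<in>I. b i * z i) \<partial>(\<Pi>\<^sub>M i\<in>I. ?N))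
      = (\<integral>\<^sup>+x. \<integral>\<^sup>+y. f (p * x, q * x + r * y) \<partial>?N \<partial>?N)"
      by (elim exE conjE) (rule that, assumption+, drule spec, erule mp)
    obtain c s where cs: "c\<^sup>2 + s\<^sup>2 = 1" "a i * c + p * s = 0" "p * c - a i * s = sqrt (p\<^sup>2 + (a i)\<^sup>2)"
      by (rule plane_rotation_onto_axis)
    define p' q' t where "p' = p * c - a i * s" and "q' = q * c - b i * s" and "t = b i * c + q * s"
    obtain c' s' where cs': "c'\<^sup>2 + s'\<^sup>2 = 1" "t * c' + r * s' = 0" "r * c' - t * s' = sqrt (r\<^sup>2 + t\<^sup>2)"
      by (rule plane_rotation_onto_axis)
    define r' where "r' = r * c' - t * s'"
    have rel: "p'\<^sup>2 = p\<^sup>2 + (a i)\<^sup>2" "r'\<^sup>2 = r\<^sup>2 + t\<^sup>2" "0 \<le> p'" "0 \<le> r'"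
      using cs cs' by (auto simp: p'_def r'_def)
    have "p' * q' = (p * q + a i * b i) * (c\<^sup>2 + s\<^sup>2) - (a i * c + p * s) * t"
      by (simp add: p'_def q'_def t_def power2_eq_square algebra_simps)
    then have rel': "p' * q' = p * q + a i * b i" using cs by simp
    have "q'\<^sup>2 + t\<^sup>2 = (q\<^sup>2 + (b i)\<^sup>2) * (c\<^sup>2 + s\<^sup>2)"
      by (simp add: q'_def t_def power2_eq_square algebra_simps)
    then have rel'': "q'\<^sup>2 + r'\<^sup>2 = q\<^sup>2 + r\<^sup>2 + (b i)\<^sup>2" using cs rel by simp
    have law: "(\<integral>\<^sup>+z. f (\<Sum>k\<in>insert i I. a k * z k, \<Sum>k\<in>insert i I. b k * z k) \<partial>(\<Pi>\<^sub>M i\<in>insert i I. ?N))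
        = (\<integral>\<^sup>+x. \<integral>\<^sup>+y. f (p' * x, q' * x + r' * y) \<partial>?N \<partial>?N)"
      if [measurable]: "f \<in> borel_measurable (borel \<Otimes>\<^sub>M borel)" for f :: "real \<times> real \<Rightarrow> ennreal"
    proof -
      have upd: "(\<Sum>k\<in>insert i I. d k * (z(i := w)) k) = d i * w + (\<Sum>k\<in>I. d k * z k)"
        for d :: "'i \<Rightarrow> real" and z w
        using insert.hyps by (simp add: sum.insert) (intro sum.cong, auto)
      have m: "(\<lambda>z. f (\<Sum>k\<in>insert i I. a k * z k, \<Sum>k\<in>insert i I. b k * z k))
          \<in> borel_measurable (\<Pi>\<^sub>M i\<in>insert i I. ?N)"
        by measurable
      have "(\<integral>\<^sup>+z. f (\<Sum>k\<in>insert i I. a k * z k, \<Sum>k\<in>insert i I. b k * z k) \<partial>(\<Pi>\<^sub>M i\<in>insert i I. ?N))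
          = (\<integral>\<^sup>+w. \<integral>\<^sup>+z. f (a i * w + (\<Sum>k\<in>I. a k * z k), b i * w + (\<Sum>k\<in>I. b k * z k))
              \<partial>(\<Pi>\<^sub>M i\<in>I. ?N) \<partial>?N)"
        by (subst product_nn_integral_insert_rev[OF insert.hyps m]) (simp only: upd)
      also have "\<dots> = (\<integral>\<^sup>+w. \<integral>\<^sup>+x. \<integral>\<^sup>+y. f (a i * w + p * x, b i * w + (q * x + r * y)) \<partial>?N \<partial>?N \<partial>?N)"
        by (intro nn_integral_cong IH[of "\<lambda>(u, v). f (a i * _ + u, b i * _ + v)", simplified])
      also have "\<dots> = (\<integral>\<^sup>+w. \<integral>\<^sup>+x. \<integral>\<^sup>+y. f (a i * (c * w - s * x) + p * (s * w + c * x),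
            b i * (c * w - s * x) + (q * (s * w + c * x) + r * y)) \<partial>?N \<partial>?N \<partial>?N)"
        by (rule std_normal_rotation[OF _ cs(1),
              of "\<lambda>z. \<integral>\<^sup>+y. f (a i * fst z + p * snd z, b i * fst z + (q * snd z + r * y)) \<partial>?N", simplified])
           measurable
      also have "\<dots> = (\<integral>\<^sup>+w. \<integral>\<^sup>+x. \<integral>\<^sup>+y. f (p' * x, q' * x + (t * w + r * y)) \<partial>?N \<partial>?N \<partial>?N)"
      proof -
        have "a i * (c * w - s * x) + p * (s * w + c * x) = (a i * c + p * s) * w + p' * x" for w x
          by (simp add: p'_def algebra_simps)
        then have e1: "a i * (c * w - s * x) + p * (s * w + c * x) = p' * x" for w x
          using cs(2) by simp
        have e2: "b i * (c * w - s * x) + (q * (s * w + c * x) + r * y) = q' * x + (t * w + r * y)" for w x y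
          by (simp add: q'_def t_def algebra_simps)
        show ?thesis by (simp only: e1 e2)
      qed
      also have "\<dots> = (\<integral>\<^sup>+x. \<integral>\<^sup>+w. \<integral>\<^sup>+y. f (p' * x, q' * x + (t * w + r * y)) \<partial>?N \<partial>?N \<partial>?N)"
        by (rule NN.Fubini'[symmetric]) measurable
      also have "\<dots> = (\<integral>\<^sup>+x. \<integral>\<^sup>+w. \<integral>\<^sup>+y. f (p' * x, q' * x + (t * (c' * w - s' * y) + r * (s' * w + c' * y))) \<partial>?N \<partial>?N \<partial>?N)"
      proof (rule nn_integral_cong)
        fix x
        show "(\<integral>\<^sup>+w. \<integral>\<^sup>+y. f (p' * x, q' * x + (t * w + r * y)) \<partial>?N \<partial>?N)
          = (\<integral>\<^sup>+w. \<integral>\<^sup>+y. f (p' * x, q' * x + (t * (c' * w - s' * y) + r * (s' * w + c' * y))) \<partial>?N \<partial>?N)"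
          by (rule std_normal_rotation[OF _ cs'(1),
              of "\<lambda>z. f (p' * x, q' * x + (t * fst z + r * snd z))", simplified]) measurable
      qed
      also have "\<dots> = (\<integral>\<^sup>+x. \<integral>\<^sup>+w. \<integral>\<^sup>+y. f (p' * x, q' * x + r' * y) \<partial>?N \<partial>?N \<partial>?N)"
      proof -
        have "t * (c' * w - s' * y) + r * (s' * w + c' * y) = (t * c' + r * s') * w + r' * y" for w y
          by (simp add: r'_def algebra_simps)
        then have "t * (c' * w - s' * y) + r * (s' * w + c' * y) = r' * y" for w y
          using cs'(2) by simp
        then show ?thesis by (simp only:)
      qed
      finally show ?thesis by (simp add: N1)
    qed
    show ?case
      by (rule exI[of _ p'], rule exI[of _ q'], rule exI[of _ r'])
         (use insert.hyps pqr rel rel' rel'' law in auto)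
  }
qed

definition cholesky_map :: "real \<Rightarrow> real \<Rightarrow> real \<Rightarrow> real \<times> real \<Rightarrow> real \<times> real" where
  "cholesky_map u v w = (\<lambda>(x, y). (sqrt u * x, v / sqrt u * x + sqrt (w - v\<^sup>2 / u) * y))"

lemma cholesky_map_measurable [measurable]:
  "cholesky_map u v w \<in> borel \<Otimes>\<^sub>M borel \<rightarrow>\<^sub>M borel \<Otimes>\<^sub>M borel"
  unfolding cholesky_map_def by measurable

text \<open>
  The law of a pair of linear forms depends on their covariance matrix only, because the triangular
  representation has nonnegative diagonal and is then the Cholesky factor of that matrix.
\<close>

lemma distr_linear_pair_std_normal:
  fixes a b :: "'i \<Rightarrow> real"
  assumes "finite I" and pos: "0 < (\<Sum>i\<in>I. (a i)\<^sup>2)"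
  shows "distr (\<Pi>\<^sub>M i\<in>I. std_normal_distribution) (borel \<Otimes>\<^sub>M borel)
       (\<lambda>z. (\<Sum>i\<in>I. a i * z i, \<Sum>i\<in>I. b i * z i))
     = distr (std_normal_distribution \<Otimes>\<^sub>M std_normal_distribution) (borel \<Otimes>\<^sub>M borel)
       (cholesky_map (\<Sum>i\<in>I. (a i)\<^sup>2) (\<Sum>i\<in>I. a i * b i) (\<Sum>i\<in>I. (b i)\<^sup>2))"
proof -
  let ?N = "std_normal_distribution"
  let ?u = "\<Sum>i\<in>I. (a i)\<^sup>2" and ?v = "\<Sum>i\<in>I. a i * b i" and ?w = "\<Sum>i\<in>I. (b i)\<^sup>2"
  interpret N: prob_space ?N by (rule prob_space_std_normal)
  from nn_integral_linear_pair[OF assms(1), of a b] obtain p q r where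
    pqr: "0 \<le> p" "0 \<le> r" "p\<^sup>2 = ?u" "p * q = ?v" "q\<^sup>2 + r\<^sup>2 = ?w"
    and law: "\<And>f :: real \<times> real \<Rightarrow> ennreal. f \<in> borel_measurable (borel \<Otimes>\<^sub>M borel) \<Longrightarrow>
        (\<integral>\<^sup>+z. f (\<Sum>i\<in>I. a i * z i, \<Sum>i\<in>I. b i * z i) \<partial>(\<Pi>\<^sub>M i\<in>I. ?N))
      = (\<integral>\<^sup>+x. \<integral>\<^sup>+y. f (p * x, q * x + r * y) \<partial>?N \<partial>?N)"
    by (elim exE conjE) (rule that, assumption+, drule spec, erule mp)
  have p: "p = sqrt ?u" using pqr by (metis real_sqrt_unique)
  then have "p > 0" using pos by simp
  then have q: "q = ?v / sqrt ?u" using pqr p by (simp add: field_simps)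
  have "?v\<^sup>2 / ?u = q\<^sup>2" using pqr \<open>p > 0\<close> unfolding pqr(4)[symmetric] pqr(3)[symmetric]
    by (simp add: power_mult_distrib)
  then have r: "r = sqrt (?w - ?v\<^sup>2 / ?u)" using pqr(2) unfolding pqr(5)[symmetric] by simp
  have chol: "cholesky_map ?u ?v ?w z = (p * fst z, q * fst z + r * snd z)" for z
    unfolding cholesky_map_def p q r by (simp add: case_prod_beta)
  have m: "(\<lambda>z. (\<Sum>i\<in>I. a i * z i, \<Sum>i\<in>I. b i * z i)) \<in> (\<Pi>\<^sub>M i\<in>I. ?N) \<rightarrow>\<^sub>M borel \<Otimes>\<^sub>M borel"
    by measurable
  show ?thesis
  proof (rule measure_eqI)
    fix A
    assume "A \<in> sets (distr (\<Pi>\<^sub>M i\<in>I. ?N) (borel \<Otimes>\<^sub>M borel) (\<lambda>z. (\<Sum>i\<in>I. a i * z i, \<Sum>i\<in>I. b i * z i)))"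
    then have A [measurable]: "A \<in> sets (borel \<Otimes>\<^sub>M borel)" by simp
    have "emeasure (distr (\<Pi>\<^sub>M i\<in>I. ?N) (borel \<Otimes>\<^sub>M borel) (\<lambda>z. (\<Sum>i\<in>I. a i * z i, \<Sum>i\<in>I. b i * z i))) A
        = (\<integral>\<^sup>+z. indicator A (\<Sum>i\<in>I. a i * z i, \<Sum>i\<in>I. b i * z i) \<partial>(\<Pi>\<^sub>M i\<in>I. ?N))"
      by (subst nn_integral_indicator[symmetric], simp, subst nn_integral_distr) simp_all
    also have "\<dots> = (\<integral>\<^sup>+x. \<integral>\<^sup>+y. indicator A (p * x, q * x + r * y) \<partial>?N \<partial>?N)"
      by (rule law) measurable
    also have "\<dots> = (\<integral>\<^sup>+z. indicator A (p * fst z, q * fst z + r * snd z) \<partial>(?N \<Otimes>\<^sub>M ?N))"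
      by (subst N.nn_integral_fst[symmetric]) simp_all
    also have "\<dots> = emeasure (distr (?N \<Otimes>\<^sub>M ?N) (borel \<Otimes>\<^sub>M borel) (\<lambda>z. (p * fst z, q * fst z + r * snd z))) A"
      by (subst nn_integral_indicator[symmetric], simp, subst nn_integral_distr) simp_all
    finally show "emeasure (distr (\<Pi>\<^sub>M i\<in>I. ?N) (borel \<Otimes>\<^sub>M borel) (\<lambda>z. (\<Sum>i\<in>I. a i * z i, \<Sum>i\<in>I. b i * z i))) A
      = emeasure (distr (?N \<Otimes>\<^sub>M ?N) (borel \<Otimes>\<^sub>M borel) (cholesky_map ?u ?v ?w)) A"
      unfolding chol[abs_def] .
  qed simp
qed

section \<open>Gaussian limits in the plane\<close>

lemma continuous_on_vector_2: "continuous_on UNIV (\<lambda>u :: real \<times> real. vector [fst u, snd u] :: real ^ 2)"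
proof -
  have eq: "(vector [fst u, snd u] :: real ^ 2) = (\<chi> i. if i = 1 then fst u else snd u)" for u :: "real \<times> real"
    by (auto simp: vec_eq_iff forall_2)
  show ?thesis
    unfolding eq
  proof (rule continuous_on_vec_lambda)
    show "continuous_on UNIV (\<lambda>u :: real \<times> real. if i = 1 then fst u else snd u)" for i :: 2
      by (cases "i = 1") (auto intro: continuous_intros)
  qed
qed

lemma vector_2_measurable [measurable]:
  "(\<lambda>u. vector [fst u, snd u] :: real ^ 2) \<in> borel \<Otimes>\<^sub>M borel \<rightarrow>\<^sub>M borel"
  unfolding borel_prod by (rule borel_measurable_continuous_onI[OF continuous_on_vector_2])

definition cholesky_matrix :: "real \<Rightarrow> real \<Rightarrow> real \<Rightarrow> real ^ 2 ^ 2" where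
  "cholesky_matrix u v w = vector [vector [sqrt u, 0], vector [v / sqrt u, sqrt (w - v\<^sup>2 / u)]]"

lemma cholesky_matrix_factor:
  assumes "0 < u" "v\<^sup>2 \<le> u * w"
  shows "cholesky_matrix u v w ** transpose (cholesky_matrix u v w) = vector [vector [u, v], vector [v, w]]"
proof -
  have "0 \<le> w - v\<^sup>2 / u" using assms by (simp add: field_simps)
  then show ?thesis
    using assms
    by (simp add: vec_eq_iff forall_2 matrix_matrix_mult_def transpose_def sum_2 cholesky_matrix_def
        power2_eq_square[symmetric] power_divide)
qed

text \<open>
  For \<open>0 < u\<close> and \<open>v\<^sup>2 \<le> u * w\<close>, the normal law with mean \<open>m\<close> and covariance matrix
  \<open>((u, v), (v, w))\<close>.
\<close>

definition normal_2 :: "real ^ 2 \<Rightarrow> real \<Rightarrow> real \<Rightarrow> real \<Rightarrow> (real ^ 2) measure" where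
  "normal_2 m u v w = distr (\<Pi>\<^sub>M i\<in>(UNIV :: 2 set). std_normal_distribution) borel
     (\<lambda>z. m + cholesky_matrix u v w *v (\<chi> i. z i))"

lemma multivariate_normal_normal_2:
  assumes "0 < u" "v\<^sup>2 \<le> u * w"
  shows "multivariate_normal m (vector [vector [u, v], vector [v, w]]) (normal_2 m u v w)"
  unfolding multivariate_normal_def normal_2_def
  using cholesky_matrix_factor[OF assms] by blast

text \<open>
  The coordinates under the product measure over the index type are themselves a pair of linear
  forms in standard normals, so the law can be moved to \<open>real \<times> real\<close>.
\<close>

lemma normal_2_eq:
  assumes "0 < u" "v\<^sup>2 \<le> u * w"
  shows "normal_2 m u v w = distr (std_normal_distribution \<Otimes>\<^sub>M std_normal_distribution) borel
    (\<lambda>z. m + vector [fst (cholesky_map u v w z), snd (cholesky_map u v w z)])"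
proof -
  let ?N = "std_normal_distribution" and ?A = "cholesky_matrix u v w"
  let ?T = "\<lambda>y. m + vector [fst y, snd y] :: real ^ 2"
  let ?lin = "\<lambda>z :: 2 \<Rightarrow> real. (\<Sum>i\<in>UNIV. ?A $ 1 $ i * z i, \<Sum>i\<in>UNIV. ?A $ 2 $ i * z i)"
  have w: "0 \<le> w - v\<^sup>2 / u" using assms by (simp add: field_simps)
  have sums: "(\<Sum>i\<in>UNIV. (?A $ 1 $ i)\<^sup>2) = u" "(\<Sum>i\<in>UNIV. ?A $ 1 $ i * ?A $ 2 $ i) = v"
    "(\<Sum>i\<in>UNIV. (?A $ 2 $ i)\<^sup>2) = w"
    using assms w by (simp_all add: sum_2 cholesky_matrix_def power_divide)
  have "m + ?A *v (\<chi> i. z i) = ?T (?lin z)" for z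
    by (simp add: vec_eq_iff forall_2 matrix_vector_mult_def)
  then have "normal_2 m u v w = distr (\<Pi>\<^sub>M i\<in>(UNIV :: 2 set). ?N) borel (?T \<circ> ?lin)"
    unfolding normal_2_def comp_def by simp
  also have "\<dots> = distr (distr (\<Pi>\<^sub>M i\<in>(UNIV :: 2 set). ?N) (borel \<Otimes>\<^sub>M borel) ?lin) borel ?T"
    by (rule distr_distr[symmetric]) measurable
  also have "distr (\<Pi>\<^sub>M i\<in>(UNIV :: 2 set). ?N) (borel \<Otimes>\<^sub>M borel) ?lin
      = distr (?N \<Otimes>\<^sub>M ?N) (borel \<Otimes>\<^sub>M borel) (cholesky_map u v w)"
    using distr_linear_pair_std_normal[of UNIV "\<lambda>i. ?A $ 1 $ i" "\<lambda>i. ?A $ 2 $ i"] assms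
    unfolding sums by simp
  also have "distr \<dots> borel ?T = distr (?N \<Otimes>\<^sub>M ?N) borel (?T \<circ> cholesky_map u v w)"
    by (rule distr_distr) measurable
  finally show ?thesis by (simp add: comp_def)
qed

lemma prob_space_normal_2:
  assumes "0 < u" "v\<^sup>2 \<le> u * w"
  shows "prob_space (normal_2 m u v w)"
proof -
  interpret N: prob_space std_normal_distribution by (rule prob_space_std_normal)
  interpret NN: pair_prob_space std_normal_distribution std_normal_distribution ..
  show ?thesis unfolding normal_2_eq[OF assms] by (rule NN.prob_space_distr) measurable
qed

lemma sets_normal_2: "sets (normal_2 m u v w) = sets borel"
  by (simp add: normal_2_def)

text \<open>
  The Cholesky factor depends continuously on the covariance matrix, so convergence of the
  covariances gives pointwise convergence of representing variables on one fixed space.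
\<close>

lemma linear_pair_converges_in_distribution:
  fixes a b :: "nat \<Rightarrow> nat \<Rightarrow> real"
  assumes u: "(\<lambda>d. \<Sum>i<d. (a d i)\<^sup>2) \<longlonglongrightarrow> u" and v: "(\<lambda>d. \<Sum>i<d. a d i * b d i) \<longlonglongrightarrow> v"
    and w: "(\<lambda>d. \<Sum>i<d. (b d i)\<^sup>2) \<longlonglongrightarrow> w"
    and pos: "0 < u" "v\<^sup>2 \<le> u * w"
  shows "converges_in_distribution std_normal_d
     (\<lambda>d z. m + vector [\<Sum>i<d. a d i * z i, \<Sum>i<d. b d i * z i]) (normal_2 m u v w)"
proof -
  let ?N = "std_normal_distribution"
  let ?lin = "\<lambda>d z. (\<Sum>i<d. a d i * z i, \<Sum>i<d. b d i * z i)"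
  let ?T = "\<lambda>y. m + vector [fst y, snd y] :: real ^ 2"
  define C where "C d = cholesky_map (\<Sum>i<d. (a d i)\<^sup>2) (\<Sum>i<d. a d i * b d i) (\<Sum>i<d. (b d i)\<^sup>2)" for d
  interpret N: prob_space ?N by (rule prob_space_std_normal)
  interpret NN: pair_prob_space ?N ?N ..
  have lin [measurable]: "?lin d \<in> std_normal_d d \<rightarrow>\<^sub>M borel \<Otimes>\<^sub>M borel" for d
    unfolding std_normal_d_def by measurable
  have T [measurable]: "?T \<in> borel \<Otimes>\<^sub>M borel \<rightarrow>\<^sub>M borel" by measurable
  have C [measurable]: "C d \<in> borel \<Otimes>\<^sub>M borel \<rightarrow>\<^sub>M borel \<Otimes>\<^sub>M borel" for d
    unfolding C_def by measurable
  have "converges_in_distribution std_normal_d (\<lambda>d z. ?T (?lin d z)) (normal_2 m u v w)"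
    unfolding converges_in_distribution_def
  proof (intro conjI allI impI)
    show "(\<lambda>z. ?T (?lin d z)) \<in> borel_measurable (std_normal_d d)" for d by measurable
    fix f :: "real ^ 2 \<Rightarrow> real"
    assume f: "continuous_on UNIV f \<and> bounded (range f)"
    then have [measurable]: "f \<in> borel_measurable borel"
      by (auto intro: borel_measurable_continuous_onI)
    from f obtain B where B: "\<And>y. norm (f y) \<le> B"
      by (metis bounded_iff rangeI)
    have law: "(\<integral>z. f (?T (?lin d z)) \<partial>std_normal_d d) = (\<integral>z. f (?T (C d z)) \<partial>(?N \<Otimes>\<^sub>M ?N))"
      if "0 < (\<Sum>i<d. (a d i)\<^sup>2)" for d
    proof -
      have "(\<integral>z. f (?T (?lin d z)) \<partial>std_normal_d d)
          = (\<integral>y. f (?T y) \<partial>distr (std_normal_d d) (borel \<Otimes>\<^sub>M borel) (?lin d))"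
        by (subst integral_distr) (auto simp: lin)
      also have "distr (std_normal_d d) (borel \<Otimes>\<^sub>M borel) (?lin d) = distr (?N \<Otimes>\<^sub>M ?N) (borel \<Otimes>\<^sub>M borel) (C d)"
        unfolding std_normal_d_def C_def
        by (rule distr_linear_pair_std_normal) (use that in auto)
      also have "(\<integral>y. f (?T y) \<partial>\<dots>) = (\<integral>z. f (?T (C d z)) \<partial>(?N \<Otimes>\<^sub>M ?N))"
        by (subst integral_distr) auto
      finally show ?thesis .
    qed
    have "(\<lambda>d. \<integral>z. f (?T (C d z)) \<partial>(?N \<Otimes>\<^sub>M ?N)) \<longlonglongrightarrow> (\<integral>z. f (?T (cholesky_map u v w z)) \<partial>(?N \<Otimes>\<^sub>M ?N))"
    proof (rule integral_dominated_convergence[where w="\<lambda>_. B"])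
      show "AE z in ?N \<Otimes>\<^sub>M ?N. (\<lambda>d. f (?T (C d z))) \<longlonglongrightarrow> f (?T (cholesky_map u v w z))"
      proof (rule AE_I2)
        fix z :: "real \<times> real"
        have "(\<lambda>d. C d z) \<longlonglongrightarrow> cholesky_map u v w z"
          unfolding C_def cholesky_map_def case_prod_beta
          using pos by (intro tendsto_intros u v w) auto
        moreover have "isCont (\<lambda>y. f (?T y)) (cholesky_map u v w z)"
        proof -
          have "continuous_on UNIV (\<lambda>y. f (?T y))"
            by (rule continuous_on_compose2[of UNIV f])
               (use f in \<open>auto intro!: continuous_on_add continuous_on_vector_2\<close>)
          then show ?thesis unfolding continuous_on_eq_continuous_at[OF open_UNIV] by blast
        qed
        ultimately show "(\<lambda>d. f (?T (C d z))) \<longlonglongrightarrow> f (?T (cholesky_map u v w z))"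
          by (rule isCont_tendsto_compose[rotated])
      qed
    qed (use B in auto)
    moreover have "\<forall>\<^sub>F d in sequentially. (\<integral>z. f (?T (C d z)) \<partial>(?N \<Otimes>\<^sub>M ?N)) = (\<integral>z. f (?T (?lin d z)) \<partial>std_normal_d d)"
      using order_tendstoD(1)[OF u \<open>0 < u\<close>] by eventually_elim (rule law[symmetric])
    moreover have "(\<integral>z. f (?T (cholesky_map u v w z)) \<partial>(?N \<Otimes>\<^sub>M ?N)) = (\<integral>y. f y \<partial>normal_2 m u v w)"
      unfolding normal_2_eq[OF pos] by (subst integral_distr) auto
    ultimately show "(\<lambda>d. \<integral>z. f (?T (?lin d z)) \<partial>std_normal_d d) \<longlonglongrightarrow> (\<integral>y. f y \<partial>normal_2 m u v w)"
      by (simp only: Lim_transform_eventually)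
  qed
  then show ?thesis by simp
qed

section \<open>Second-order expansion under Gaussian perturbations\<close>

lemma thrice_differentiable_derivs:
  assumes "thrice_differentiable f" and "k < 3"
  shows "((deriv ^^ k) f has_real_derivative (deriv ^^ Suc k) f x) (at x)"
  using assms by (simp add: thrice_differentiable_def DERIV_deriv_iff_real_differentiable)

lemma thrice_differentiable_continuous:
  assumes "thrice_differentiable f" and "k < 3"
  shows "continuous_on UNIV ((deriv ^^ k) f)"
  using DERIV_isCont[OF thrice_differentiable_derivs[OF assms]] by (simp add: continuous_at_imp_continuous_on)

lemma quadratic_expansion_error:
  assumes f: "thrice_differentiable f" and K: "\<And>x. \<bar>(deriv ^^ 3) f x\<bar> \<le> K"
  shows "\<bar>f (x + h) - f x - deriv f x * h - (deriv ^^ 2) f x / 2 * h\<^sup>2\<bar> \<le> K / 6 * \<bar>h\<bar> ^ 3"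
proof -
  have "\<exists>t. \<bar>t\<bar> \<le> \<bar>h\<bar> \<and> f (x + h) = (\<Sum>m<3. (deriv ^^ m) f (x + 0) / fact m * h ^ m)
      + (deriv ^^ 3) f (x + t) / fact 3 * h ^ 3"
  proof (rule Maclaurin_bi_le[where diff="\<lambda>m t. (deriv ^^ m) f (x + t)" and f="\<lambda>t. f (x + t)"])
    have "((\<lambda>t. (deriv ^^ m) f (x + t)) has_real_derivative (deriv ^^ Suc m) f (x + t)) (at t)"
      if "m < 3" for m t
      using thrice_differentiable_derivs[OF f that, of "t + x"]
        DERIV_shift[of "(deriv ^^ m) f" "(deriv ^^ Suc m) f (t + x)" t x]
      by (simp add: add.commute)
    then show "\<forall>m t. m < 3 \<and> \<bar>t\<bar> \<le> \<bar>h\<bar> \<longrightarrow>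
        ((\<lambda>t. (deriv ^^ m) f (x + t)) has_real_derivative (deriv ^^ Suc m) f (x + t)) (at t)"
      by blast
  qed simp
  then obtain t where "f (x + h) = (\<Sum>m<3. (deriv ^^ m) f x / fact m * h ^ m) + (deriv ^^ 3) f (x + t) / fact 3 * h ^ 3"
    by auto
  then have "f (x + h) - f x - deriv f x * h - (deriv ^^ 2) f x / 2 * h\<^sup>2 = (deriv ^^ 3) f (x + t) / 6 * h ^ 3"
    by (simp add: eval_nat_numeral)
  moreover have "\<bar>(deriv ^^ 3) f (x + t) / 6 * h ^ 3\<bar> \<le> K / 6 * \<bar>h\<bar> ^ 3"
    unfolding abs_mult power_abs[symmetric] using K[of "x + t"]
    by (intro mult_right_mono) (auto simp: abs_divide)
  ultimately show ?thesis by (simp only:)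
qed

lemma std_normal_d_component:
  assumes "i < d" and [measurable]: "g \<in> borel_measurable borel"
  shows "integrable (std_normal_d d) (\<lambda>z. g (z i)) \<longleftrightarrow> integrable std_normal_distribution (g :: real \<Rightarrow> real)"
    and "(\<integral>z. g (z i) \<partial>std_normal_d d) = (\<integral>x. g x \<partial>std_normal_distribution)"
proof -
  have law: "distr (std_normal_d d) std_normal_distribution (\<lambda>z. z i) = std_normal_distribution"
    unfolding std_normal_d_def using assms(1)
    by (intro distr_PiM_component) (auto intro: prob_space_std_normal)
  have m: "(\<lambda>z. z i) \<in> std_normal_d d \<rightarrow>\<^sub>M std_normal_distribution"
    unfolding std_normal_d_def using assms(1) by (intro measurable_component_singleton) auto
  from integrable_distr_eq[OF m, of g]
  show "integrable (std_normal_d d) (\<lambda>z. g (z i)) \<longleftrightarrow> integrable std_normal_distribution g"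
    unfolding law by simp
  from integral_distr[OF m, of g]
  show "(\<integral>z. g (z i) \<partial>std_normal_d d) = (\<integral>x. g x \<partial>std_normal_distribution)"
    unfolding law by simp
qed

lemma prob_space_std_normal_d: "prob_space (std_normal_d d)"
  unfolding std_normal_d_def by (rule prob_space_PiM) (rule prob_space_std_normal)

lemma std_normal_integrals:
  shows "integrable std_normal_distribution (\<lambda>x. \<bar>x\<bar> ^ 3)"
    and "integrable std_normal_distribution (\<lambda>x. x\<^sup>2 - 1)"
    and "integrable std_normal_distribution (\<lambda>x. (x\<^sup>2 - 1)\<^sup>2)"
    and "(\<integral>x. x\<^sup>2 - 1 \<partial>std_normal_distribution) = 0"
proof -
  interpret N: prob_space std_normal_distribution by (rule prob_space_std_normal)
  have abs3: "integrable lborel (\<lambda>x. std_normal_density x * \<bar>x\<bar> ^ 3)"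
    by (rule integrable_std_normal_moment_abs)
  then show "integrable std_normal_distribution (\<lambda>x. \<bar>x\<bar> ^ 3)"
    by (subst integrable_density) (auto simp: normal_density_nonneg)
  note mom = integrable_std_normal_distribution_moment
  show "integrable std_normal_distribution (\<lambda>x. x\<^sup>2 - 1)" using mom[of 2] by simp
  have "(\<lambda>x :: real. (x\<^sup>2 - 1)\<^sup>2) = (\<lambda>x. x ^ 4 - 2 * x\<^sup>2 + 1)"
    by (auto simp: fun_eq_iff power2_eq_square eval_nat_numeral algebra_simps)
  then show "integrable std_normal_distribution (\<lambda>x. (x\<^sup>2 - 1)\<^sup>2)"
    using mom[of 4] mom[of 2] by simp
  have "(\<integral>x. x\<^sup>2 \<partial>std_normal_distribution) = 1"
    using std_normal_moment_even[of 1]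
    by (subst integral_density) (auto simp: normal_density_nonneg has_bochner_integral_iff)
  then show "(\<integral>x. x\<^sup>2 - 1 \<partial>std_normal_distribution) = 0"
    using mom[of 2] by (simp add: N.prob_space[simplified])
qed

lemma std_normal_d_uncorrelated:
  assumes ij: "i < d" "j < d" "i \<noteq> j" and [measurable]: "g \<in> borel_measurable borel" "h \<in> borel_measurable borel"
    and g: "integrable std_normal_distribution g" and h: "integrable std_normal_distribution h"
  shows "(\<integral>z. g (z i) * h (z j) \<partial>std_normal_d d)
    = (\<integral>x. g x \<partial>std_normal_distribution) * (\<integral>x. (h x :: real) \<partial>std_normal_distribution)"
proof -
  interpret P: prob_space "std_normal_d d" by (rule prob_space_std_normal_d)
  have "P.indep_vars (\<lambda>_. std_normal_distribution) (\<lambda>i z. z i) {..<d}"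
  proof (subst P.indep_vars_iff_distr_eq_PiM')
    show "{..<d} \<noteq> {}" using ij by auto
    show m: "(\<lambda>z. z i) \<in> std_normal_d d \<rightarrow>\<^sub>M std_normal_distribution" if "i \<in> {..<d}" for i
      unfolding std_normal_d_def using that by (intro measurable_component_singleton) auto
    have "distr (std_normal_d d) (\<Pi>\<^sub>M i\<in>{..<d}. std_normal_distribution) (\<lambda>z. \<lambda>i\<in>{..<d}. z i)
        = distr (std_normal_d d) (std_normal_d d) (\<lambda>z. z)"
      by (rule distr_cong) (auto simp: std_normal_d_def space_PiM)
    also have "\<dots> = (\<Pi>\<^sub>M i\<in>{..<d}. std_normal_distribution)"
      by (simp add: distr_id std_normal_d_def)
    also have "\<dots> = (\<Pi>\<^sub>M i\<in>{..<d}. distr (std_normal_d d) std_normal_distribution (\<lambda>z. z i))"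
      unfolding std_normal_d_def
      by (intro PiM_cong distr_PiM_component[symmetric]) (auto intro: prob_space_std_normal)
    finally show "distr (std_normal_d d) (\<Pi>\<^sub>M i\<in>{..<d}. std_normal_distribution) (\<lambda>z. \<lambda>i\<in>{..<d}. z i)
        = (\<Pi>\<^sub>M i\<in>{..<d}. distr (std_normal_d d) std_normal_distribution (\<lambda>z. z i))" .
  qed
  then have "P.indep_var std_normal_distribution (\<lambda>z. z i) std_normal_distribution (\<lambda>z. z j)"
    using ij by (intro P.indep_vars_imp_indep_var[where I="{..<d}"]) auto
  then have "P.indep_var borel (g \<circ> (\<lambda>z. z i)) borel (h \<circ> (\<lambda>z. z j))"
    by (rule P.indep_var_compose) simp_all
  moreover have "integrable (std_normal_d d) (g \<circ> (\<lambda>z. z i))" "integrable (std_normal_d d) (h \<circ> (\<lambda>z. z j))"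
    using std_normal_d_component(1)[OF ij(1), of g] std_normal_d_component(1)[OF ij(2), of h] g h
    by (simp_all add: comp_def)
  ultimately have "(\<integral>z. (g \<circ> (\<lambda>z. z i)) z * (h \<circ> (\<lambda>z. z j)) z \<partial>std_normal_d d)
      = (\<integral>z. (g \<circ> (\<lambda>z. z i)) z \<partial>std_normal_d d) * (\<integral>z. (h \<circ> (\<lambda>z. z j)) z \<partial>std_normal_d d)"
    by (rule P.indep_var_lebesgue_integral)
  then show ?thesis
    unfolding comp_def std_normal_d_component(2)[OF ij(1) assms(4)] std_normal_d_component(2)[OF ij(2) assms(5)] .
qed

lemma integral_abs_le_sqrt_integral_power2:
  fixes f :: "'a \<Rightarrow> real"
  assumes "prob_space M" "f \<in> borel_measurable M" "integrable M (\<lambda>x. (f x)\<^sup>2)"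
  shows "integrable M f" and "(\<integral>x. \<bar>f x\<bar> \<partial>M) \<le> sqrt (\<integral>x. (f x)\<^sup>2 \<partial>M)"
proof -
  interpret prob_space M by fact
  show int: "integrable M f"
    by (rule square_integrable_imp_integrable) (use assms in auto)
  have "0 \<le> (\<integral>x. (\<bar>f x\<bar> - expectation (\<lambda>x. \<bar>f x\<bar>))\<^sup>2 \<partial>M)" by simp
  also have "\<dots> = (\<integral>x. (f x)\<^sup>2 \<partial>M) - (expectation (\<lambda>x. \<bar>f x\<bar>))\<^sup>2"
    using variance_eq[of "\<lambda>x. \<bar>f x\<bar>"] int assms(3) by simp
  finally show "(\<integral>x. \<bar>f x\<bar> \<partial>M) \<le> sqrt (\<integral>x. (f x)\<^sup>2 \<partial>M)"
    by (intro real_le_rsqrt) simp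
qed

text \<open>
  Second-order expansion of a sum of smooth functions under Gaussian perturbations of size
  \<open>\<tau> / sqrt d\<close>, up to an error that vanishes in mean. The cubic terms add up to order
  \<open>d * d powr (- 3 / 2)\<close>; in the quadratic terms \<open>z\<^sup>2\<close> may be replaced by its mean \<open>1\<close>, because
  the centred terms are uncorrelated and have total variance of order \<open>1 / d\<close>.
\<close>

lemma quadratic_expansion_of_sum:
  fixes \<phi> :: "nat \<Rightarrow> real \<Rightarrow> real" and x :: "nat \<Rightarrow> real" and \<tau> \<kappa> K :: real
  assumes diff: "\<And>i. thrice_differentiable (\<phi> i)"
    and K2: "\<And>i x. \<bar>(deriv ^^ 2) (\<phi> i) x\<bar> \<le> K" and K3: "\<And>i x. \<bar>(deriv ^^ 3) (\<phi> i) x\<bar> \<le> K"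
    and mean: "(\<lambda>d. (\<Sum>i<d. (deriv ^^ 2) (\<phi> i) (x i)) / real d) \<longlonglongrightarrow> \<kappa>"
  defines "R \<equiv> \<lambda>d z. (\<Sum>i<d. \<phi> i (x i + \<tau> / sqrt (real d) * z i) - \<phi> i (x i))
      - (\<Sum>i<d. \<tau> / sqrt (real d) * deriv (\<phi> i) (x i) * z i) - \<tau>\<^sup>2 / 2 * \<kappa>"
  shows "integrable (std_normal_d d) (R d)"
    and "(\<lambda>d. \<integral>z. \<bar>R d z\<bar> \<partial>std_normal_d d) \<longlonglongrightarrow> 0"
proof -
  define \<sigma> where "\<sigma> d = \<tau> / sqrt (real d)" for d
  define c where "c i = (deriv ^^ 2) (\<phi> i) (x i)" for i
  have c: "\<bar>c i\<bar> \<le> K" for i using K2 by (simp add: c_def)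
  have "K \<ge> 0" using c[of 0] by linarith
  \<comment> \<open>cubic remainder, fluctuation of the quadratic terms, and defect of their mean\<close>
  define cub where "cub d z = (\<Sum>i<d. \<phi> i (x i + \<sigma> d * z i) - \<phi> i (x i) - deriv (\<phi> i) (x i) * (\<sigma> d * z i)
      - c i / 2 * (\<sigma> d * z i)\<^sup>2)" for d z
  define quad where "quad d z = (\<Sum>i<d. (\<sigma> d)\<^sup>2 / 2 * c i * ((z i)\<^sup>2 - 1))" for d and z :: "nat \<Rightarrow> real"
  define del where "del d = (\<sigma> d)\<^sup>2 / 2 * (\<Sum>i<d. c i) - \<tau>\<^sup>2 / 2 * \<kappa>" for d
  have quad_eq: "quad d z = (\<Sum>i<d. c i / 2 * (\<sigma> d * z i)\<^sup>2) - (\<sigma> d)\<^sup>2 / 2 * (\<Sum>i<d. c i)" for d z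
    unfolding quad_def sum_distrib_left sum_subtractf[symmetric]
    by (intro sum.cong refl) (simp add: field_simps)
  have R: "R d z = cub d z + quad d z + del d" for d z
    unfolding R_def \<sigma>_def[symmetric] cub_def quad_eq del_def
    by (simp add: sum.distrib sum_subtractf algebra_simps)
  define m3 where "m3 = (\<integral>x. \<bar>x\<bar> ^ 3 \<partial>std_normal_distribution)"
  define v where "v = (\<integral>x. (x\<^sup>2 - 1)\<^sup>2 \<partial>std_normal_distribution)"
  have z [measurable]: "(\<lambda>z. z i) \<in> borel_measurable (std_normal_d d)" if "i < d" for i d
  proof -
    have "(\<lambda>z. z i) \<in> std_normal_d d \<rightarrow>\<^sub>M std_normal_distribution"
      unfolding std_normal_d_def using that by (intro measurable_component_singleton) auto
    then show ?thesis by simp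
  qed
  have [measurable]: "\<phi> i \<in> borel_measurable borel" for i
    using thrice_differentiable_continuous[OF diff, of 0 i] by (simp add: borel_measurable_continuous_onI)
  have cub_m: "cub d \<in> borel_measurable (std_normal_d d)" for d
    unfolding cub_def by (intro borel_measurable_sum) (use z in measurable)
  have quad_m: "quad d \<in> borel_measurable (std_normal_d d)" for d
    unfolding quad_def by (intro borel_measurable_sum) (use z in measurable)
  have cub_le: "\<bar>cub d z\<bar> \<le> (\<Sum>i<d. K / 6 * \<bar>\<sigma> d\<bar> ^ 3 * \<bar>z i\<bar> ^ 3)" for d z
    unfolding cub_def
  proof (rule order.trans[OF sum_abs sum_mono])
    fix i
    show "\<bar>\<phi> i (x i + \<sigma> d * z i) - \<phi> i (x i) - deriv (\<phi> i) (x i) * (\<sigma> d * z i) - c i / 2 * (\<sigma> d * z i)\<^sup>2\<bar>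
        \<le> K / 6 * \<bar>\<sigma> d\<bar> ^ 3 * \<bar>z i\<bar> ^ 3"
      using quadratic_expansion_error[OF diff[of i] K3, of "x i" "\<sigma> d * z i"]
      by (simp add: c_def abs_mult power_mult_distrib mult.assoc)
  qed
  have int3: "integrable (std_normal_d d) (\<lambda>z. \<bar>z i\<bar> ^ 3)" "(\<integral>z. \<bar>z i\<bar> ^ 3 \<partial>std_normal_d d) = m3"
    if "i < d" for i d
    using std_normal_d_component[OF that, of "\<lambda>x. \<bar>x\<bar> ^ 3"] std_normal_integrals(1) by (simp_all add: m3_def)
  have bound_int: "integrable (std_normal_d d) (\<lambda>z. \<Sum>i<d. K / 6 * \<bar>\<sigma> d\<bar> ^ 3 * \<bar>z i\<bar> ^ 3)" for d
    by (intro Bochner_Integration.integrable_sum integrable_mult_right int3) simp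
  have cub_int: "integrable (std_normal_d d) (cub d)" for d
    by (rule Bochner_Integration.integrable_bound[OF bound_int cub_m])
       (use cub_le in \<open>auto intro!: AE_I2 intro: order.trans[OF _ abs_ge_self]\<close>)
  have cub_mean: "(\<integral>z. \<bar>cub d z\<bar> \<partial>std_normal_d d) \<le> real d * (K / 6 * \<bar>\<sigma> d\<bar> ^ 3 * m3)" for d
  proof -
    have "(\<integral>z. \<bar>cub d z\<bar> \<partial>std_normal_d d) \<le> (\<integral>z. (\<Sum>i<d. K / 6 * \<bar>\<sigma> d\<bar> ^ 3 * \<bar>z i\<bar> ^ 3) \<partial>std_normal_d d)"
      by (intro integral_mono integrable_abs cub_int bound_int cub_le)
    also have "\<dots> = (\<Sum>i<d. \<integral>z. K / 6 * \<bar>\<sigma> d\<bar> ^ 3 * \<bar>z i\<bar> ^ 3 \<partial>std_normal_d d)"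
      by (intro Bochner_Integration.integral_sum integrable_mult_right int3) simp
    also have "\<dots> = (\<Sum>i<d. K / 6 * \<bar>\<sigma> d\<bar> ^ 3 * m3)"
      by (intro sum.cong) (simp_all add: int3)
    finally show ?thesis by simp
  qed
  define Y where "Y d i z = (\<sigma> d)\<^sup>2 / 2 * c i * ((z i)\<^sup>2 - 1)" for d i and z :: "nat \<Rightarrow> real"
  have Y_sq: "integrable (std_normal_d d) (\<lambda>z. (Y d i z)\<^sup>2)"
    "(\<integral>z. (Y d i z)\<^sup>2 \<partial>std_normal_d d) = ((\<sigma> d)\<^sup>2 / 2 * c i)\<^sup>2 * v" if "i < d" for d i
    using std_normal_d_component[OF that, of "\<lambda>x. (x\<^sup>2 - 1)\<^sup>2"] std_normal_integrals(3)
    by (simp_all add: Y_def power_mult_distrib v_def del: times_divide_eq_left times_divide_eq_right)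
  have Y_uncorr: "(\<integral>z. Y d i z * Y d j z \<partial>std_normal_d d) = 0" if "i < d" "j < d" "i \<noteq> j" for d i j
  proof -
    have "Y d i z * Y d j z = ((\<sigma> d)\<^sup>2 / 2 * c i * ((\<sigma> d)\<^sup>2 / 2 * c j)) * (((z i)\<^sup>2 - 1) * ((z j)\<^sup>2 - 1))" for z
      by (simp only: Y_def mult_ac)
    moreover have "(\<integral>z. ((z i)\<^sup>2 - 1) * ((z j)\<^sup>2 - 1) \<partial>std_normal_d d) = 0"
      using std_normal_d_uncorrelated[OF that, of "\<lambda>x. x\<^sup>2 - 1" "\<lambda>x. x\<^sup>2 - 1"] std_normal_integrals(2,4)
      by simp
    ultimately show ?thesis by (simp only: integral_mult_right_zero mult_zero_right)
  qed
  have Y_m: "Y d i \<in> borel_measurable (std_normal_d d)" if "i < d" for d i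
    unfolding Y_def using z[OF that] by measurable
  have quad_Y: "quad d z = (\<Sum>i<d. Y d i z)" for d z by (simp add: quad_def Y_def)
  have quad_sq: "integrable (std_normal_d d) (\<lambda>z. (quad d z)\<^sup>2)" for d
    unfolding quad_Y by (rule second_moment_sum_uncorrelated(1)) (use Y_m Y_sq Y_uncorr in auto)
  have quad_int: "integrable (std_normal_d d) (quad d)" for d
    by (rule integral_abs_le_sqrt_integral_power2(1)[OF prob_space_std_normal_d quad_m quad_sq])
  have v0: "v \<ge> 0" by (simp add: v_def)
  have quad_mean: "(\<integral>z. \<bar>quad d z\<bar> \<partial>std_normal_d d) \<le> sqrt (real d * (((\<sigma> d)\<^sup>2 / 2 * K)\<^sup>2 * v))" for d
  proof -
    have "(\<integral>z. \<bar>quad d z\<bar> \<partial>std_normal_d d) \<le> sqrt (\<integral>z. (quad d z)\<^sup>2 \<partial>std_normal_d d)"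
      by (rule integral_abs_le_sqrt_integral_power2(2)[OF prob_space_std_normal_d quad_m quad_sq])
    also have "(\<integral>z. (quad d z)\<^sup>2 \<partial>std_normal_d d) = (\<Sum>i<d. \<integral>z. (Y d i z)\<^sup>2 \<partial>std_normal_d d)"
      unfolding quad_Y by (rule second_moment_sum_uncorrelated(2)) (use Y_m Y_sq Y_uncorr in auto)
    also have "\<dots> \<le> (\<Sum>i<d. ((\<sigma> d)\<^sup>2 / 2 * K)\<^sup>2 * v)"
    proof (rule sum_mono)
      fix i assume "i \<in> {..<d}"
      have "\<bar>(\<sigma> d)\<^sup>2 / 2 * c i\<bar> \<le> \<bar>(\<sigma> d)\<^sup>2 / 2 * K\<bar>"
        unfolding abs_mult using c[of i] \<open>K \<ge> 0\<close> by (intro mult_left_mono) auto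
      then have "((\<sigma> d)\<^sup>2 / 2 * c i)\<^sup>2 \<le> ((\<sigma> d)\<^sup>2 / 2 * K)\<^sup>2" by (simp only: abs_le_square_iff)
      then have "((\<sigma> d)\<^sup>2 / 2 * c i)\<^sup>2 * v \<le> ((\<sigma> d)\<^sup>2 / 2 * K)\<^sup>2 * v" by (rule mult_right_mono[OF _ v0])
      then show "(\<integral>z. (Y d i z)\<^sup>2 \<partial>std_normal_d d) \<le> ((\<sigma> d)\<^sup>2 / 2 * K)\<^sup>2 * v"
        using Y_sq(2)[of i d] \<open>i \<in> {..<d}\<close> by simp
    qed
    finally show ?thesis by simp
  qed
  interpret P: prob_space "std_normal_d d" for d by (rule prob_space_std_normal_d)
  show int: "integrable (std_normal_d d) (R d)" for d
    unfolding R[abs_def] using cub_int[of d] quad_int[of d] by simp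
  have le: "(\<integral>z. \<bar>R d z\<bar> \<partial>std_normal_d d)
      \<le> real d * (K / 6 * \<bar>\<sigma> d\<bar> ^ 3 * m3) + sqrt (real d * (((\<sigma> d)\<^sup>2 / 2 * K)\<^sup>2 * v)) + \<bar>del d\<bar>" for d
  proof -
    have "(\<integral>z. \<bar>R d z\<bar> \<partial>std_normal_d d) \<le> (\<integral>z. \<bar>cub d z\<bar> + \<bar>quad d z\<bar> + \<bar>del d\<bar> \<partial>std_normal_d d)"
      by (intro integral_mono integrable_abs int Bochner_Integration.integrable_add cub_int quad_int P.integrable_const)
         (simp add: R)
    also have "\<dots> = (\<integral>z. \<bar>cub d z\<bar> \<partial>std_normal_d d) + (\<integral>z. \<bar>quad d z\<bar> \<partial>std_normal_d d) + \<bar>del d\<bar>"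
      using cub_int quad_int by (simp add: P.prob_space)
    finally show ?thesis using cub_mean[of d] quad_mean[of d] by linarith
  qed
  have lim: "(\<lambda>d. real d * (K / 6 * \<bar>\<sigma> d\<bar> ^ 3 * m3) + sqrt (real d * (((\<sigma> d)\<^sup>2 / 2 * K)\<^sup>2 * v)) + \<bar>del d\<bar>)
      \<longlonglongrightarrow> 0 + 0 + \<bar>0\<bar>"
  proof (intro tendsto_intros)
    have inv: "(\<lambda>d. C / sqrt (real d)) \<longlonglongrightarrow> 0" for C :: real
      by (intro tendsto_divide_0[OF tendsto_const] filterlim_at_top_imp_at_infinity
          filterlim_compose[OF sqrt_at_top] filterlim_real_sequentially)
    have "\<forall>\<^sub>F d in sequentially. K / 6 * \<bar>\<tau>\<bar> ^ 3 * m3 / sqrt (real d) = real d * (K / 6 * \<bar>\<sigma> d\<bar> ^ 3 * m3)"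
    proof (rule eventually_sequentiallyI[of 1])
      fix d :: nat assume "1 \<le> d"
      define s where "s = sqrt (real d)"
      have "s > 0" "real d = s\<^sup>2" using \<open>1 \<le> d\<close> by (auto simp: s_def)
      then show "K / 6 * \<bar>\<tau>\<bar> ^ 3 * m3 / sqrt (real d) = real d * (K / 6 * \<bar>\<sigma> d\<bar> ^ 3 * m3)"
        unfolding \<sigma>_def s_def[symmetric] by (simp add: abs_divide power_divide field_simps eval_nat_numeral)
    qed
    from Lim_transform_eventually[OF inv this]
    show "(\<lambda>d. real d * (K / 6 * \<bar>\<sigma> d\<bar> ^ 3 * m3)) \<longlonglongrightarrow> 0" .
    have "\<forall>\<^sub>F d in sequentially. \<tau>\<^sup>2 / 2 * K * sqrt v / sqrt (real d) = sqrt (real d * (((\<sigma> d)\<^sup>2 / 2 * K)\<^sup>2 * v))"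
    proof (rule eventually_sequentiallyI[of 1])
      fix d :: nat assume "1 \<le> d"
      define s where "s = sqrt (real d)"
      have s: "s > 0" "real d = s\<^sup>2" using \<open>1 \<le> d\<close> by (auto simp: s_def)
      have "sqrt (real d * (((\<sigma> d)\<^sup>2 / 2 * K)\<^sup>2 * v)) = s * ((\<sigma> d)\<^sup>2 / 2 * K * sqrt v)"
        using \<open>K \<ge> 0\<close> by (simp add: real_sqrt_mult s_def)
      also have "\<dots> = \<tau>\<^sup>2 / 2 * K * sqrt v / sqrt (real d)"
        unfolding \<sigma>_def s_def[symmetric] using s by (simp add: power_divide field_simps power2_eq_square)
      finally show "\<tau>\<^sup>2 / 2 * K * sqrt v / sqrt (real d) = sqrt (real d * (((\<sigma> d)\<^sup>2 / 2 * K)\<^sup>2 * v))" by simp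
    qed
    from Lim_transform_eventually[OF inv this]
    show "(\<lambda>d. sqrt (real d * (((\<sigma> d)\<^sup>2 / 2 * K)\<^sup>2 * v))) \<longlonglongrightarrow> 0" .
    have "(\<lambda>d. \<tau>\<^sup>2 / 2 * ((\<Sum>i<d. c i) / real d) - \<tau>\<^sup>2 / 2 * \<kappa>) \<longlonglongrightarrow> \<tau>\<^sup>2 / 2 * \<kappa> - \<tau>\<^sup>2 / 2 * \<kappa>"
      unfolding c_def by (intro tendsto_intros mean)
    then show "del \<longlonglongrightarrow> 0"
      by (simp add: del_def[abs_def] \<sigma>_def power_divide mult.commute)
  qed
  show "(\<lambda>d. \<integral>z. \<bar>R d z\<bar> \<partial>std_normal_d d) \<longlonglongrightarrow> 0"
    by (rule Lim_null_comparison[OF _ lim[simplified]]) (use le in \<open>auto intro!: always_eventually\<close>)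
qed

section \<open>A strong law of large numbers\<close>

text \<open>
  For nonnegative terms a law of large numbers along the squares suffices: between \<open>k\<^sup>2\<close> and
  \<open>(k + 1)\<^sup>2\<close> the partial sums are monotone, and the quotient of the two squares tends to \<open>1\<close>.
\<close>

lemma mean_tendsto_from_squares:
  fixes y :: "nat \<Rightarrow> real"
  assumes nonneg: "\<And>i. 0 \<le> y i"
    and sq: "(\<lambda>k. (\<Sum>i<k\<^sup>2. y i) / real (k\<^sup>2)) \<longlonglongrightarrow> m"
  shows "(\<lambda>n. (\<Sum>i<n. y i) / real n) \<longlonglongrightarrow> m"
proof -
  define S where "S n = (\<Sum>i<n. y i)" for n
  have mono: "S i \<le> S j" if "i \<le> j" for i j
    unfolding S_def using that nonneg by (intro sum_mono2) auto
  have S0: "0 \<le> S n" for n unfolding S_def using nonneg by (intro sum_nonneg) auto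
  \<comment> \<open>\<open>r n\<close> is the \<open>k\<close> with \<open>k\<^sup>2 \<le> n < (k + 1)\<^sup>2\<close>\<close>
  define r where "r n = nat \<lfloor>sqrt (real n)\<rfloor>" for n
  have r: "(r n)\<^sup>2 \<le> n" "n \<le> (Suc (r n))\<^sup>2" for n
  proof -
    have "real (r n) \<le> sqrt (real n)" unfolding r_def by (simp add: of_nat_nat)
    then have "(real (r n))\<^sup>2 \<le> real n"
      using power_mono[of "real (r n)" "sqrt (real n)" 2] by simp
    then show "(r n)\<^sup>2 \<le> n" by (metis of_nat_le_iff of_nat_power)
    have "sqrt (real n) \<le> real (Suc (r n))" unfolding r_def by linarith
    then have "real n \<le> (real (Suc (r n)))\<^sup>2" by (rule sqrt_le_D)
    then show "n \<le> (Suc (r n))\<^sup>2" by (metis of_nat_le_iff of_nat_power)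
  qed
  have r_lim: "filterlim r at_top sequentially"
    unfolding filterlim_at_top
  proof (intro allI)
    fix Z
    have "Z \<le> r n" if "n \<ge> Z\<^sup>2" for n
    proof -
      have "real Z \<le> sqrt (real n)" using that by (intro real_le_rsqrt) (metis of_nat_le_iff of_nat_power)
      then show ?thesis unfolding r_def by (simp add: le_nat_floor)
    qed
    then show "\<forall>\<^sub>F n in sequentially. Z \<le> r n" by (rule eventually_sequentiallyI)
  qed
  have q1: "(\<lambda>k. real k / real (Suc k)) \<longlonglongrightarrow> 1" by (rule LIMSEQ_n_over_Suc_n)
  have q2: "(\<lambda>k. real (Suc k) / real k) \<longlonglongrightarrow> 1" by (rule LIMSEQ_Suc_n_over_n)
  have "(\<lambda>k. S (k\<^sup>2) / real (k\<^sup>2) * (real k / real (Suc k))\<^sup>2) \<longlonglongrightarrow> m * 1\<^sup>2"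
    unfolding S_def by (intro tendsto_intros sq q1)
  then have lo: "(\<lambda>n. S ((r n)\<^sup>2) / real ((r n)\<^sup>2) * (real (r n) / real (Suc (r n)))\<^sup>2) \<longlonglongrightarrow> m"
    using filterlim_compose[OF _ r_lim] by simp
  have "(\<lambda>k. S ((Suc k)\<^sup>2) / real ((Suc k)\<^sup>2) * (real (Suc k) / real k)\<^sup>2) \<longlonglongrightarrow> m * 1\<^sup>2"
    unfolding S_def by (intro tendsto_intros q2 LIMSEQ_Suc[OF sq])
  then have hi: "(\<lambda>n. S ((Suc (r n))\<^sup>2) / real ((Suc (r n))\<^sup>2) * (real (Suc (r n)) / real (r n))\<^sup>2) \<longlonglongrightarrow> m"
    using filterlim_compose[OF _ r_lim] by simp
  have "\<forall>\<^sub>F n in sequentially. 1 \<le> r n"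
    using r_lim by (simp add: filterlim_at_top)
  then have pos: "\<forall>\<^sub>F n in sequentially. 0 < r n" by eventually_elim simp
  have "(\<lambda>n. S n / real n) \<longlonglongrightarrow> m"
  proof (rule tendsto_sandwich[OF _ _ lo hi])
    show "\<forall>\<^sub>F n in sequentially. S ((r n)\<^sup>2) / real ((r n)\<^sup>2) * (real (r n) / real (Suc (r n)))\<^sup>2 \<le> S n / real n"
      using pos
    proof eventually_elim
      fix n assume "0 < r n"
      then have "0 < n" using r(1)[of n] by (metis gr0I le_zero_eq power_eq_0_iff less_numeral_extra(3))
      have "S ((r n)\<^sup>2) / real ((r n)\<^sup>2) * (real (r n) / real (Suc (r n)))\<^sup>2 = S ((r n)\<^sup>2) / real ((Suc (r n))\<^sup>2)"
        using \<open>0 < r n\<close> by (simp add: power_divide)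
      also have "\<dots> \<le> S n / real n"
        using r[of n] \<open>0 < n\<close> S0 by (intro frac_le mono) (auto simp flip: of_nat_power simp del: of_nat_Suc)
      finally show "S ((r n)\<^sup>2) / real ((r n)\<^sup>2) * (real (r n) / real (Suc (r n)))\<^sup>2 \<le> S n / real n" .
    qed
    show "\<forall>\<^sub>F n in sequentially. S n / real n \<le> S ((Suc (r n))\<^sup>2) / real ((Suc (r n))\<^sup>2) * (real (Suc (r n)) / real (r n))\<^sup>2"
      using pos
    proof eventually_elim
      fix n assume "0 < r n"
      have "S n / real n \<le> S ((Suc (r n))\<^sup>2) / real ((r n)\<^sup>2)"
        using r[of n] \<open>0 < r n\<close> S0 by (intro frac_le mono) (auto simp flip: of_nat_power simp del: of_nat_Suc)
      also have "\<dots> = S ((Suc (r n))\<^sup>2) / real ((Suc (r n))\<^sup>2) * (real (Suc (r n)) / real (r n))\<^sup>2"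
        using \<open>0 < r n\<close> by (simp add: power_divide del: of_nat_Suc)
      finally show "S n / real n \<le> S ((Suc (r n))\<^sup>2) / real ((Suc (r n))\<^sup>2) * (real (Suc (r n)) / real (r n))\<^sup>2" .
    qed
  qed
  then show ?thesis by (simp add: S_def)
qed

lemma AE_tendsto_0_of_summable_integrals:
  fixes f :: "nat \<Rightarrow> 'a \<Rightarrow> real"
  assumes int: "\<And>n. integrable M (f n)" and nonneg: "\<And>n x. 0 \<le> f n x"
    and sum: "summable (\<lambda>n. \<integral>x. f n x \<partial>M)"
  shows "AE x in M. (\<lambda>n. f n x) \<longlonglongrightarrow> 0"
proof -
  have [measurable]: "f n \<in> borel_measurable M" for n using int by auto
  have "(\<integral>\<^sup>+x. (\<Sum>n. ennreal (f n x)) \<partial>M) = (\<Sum>n. \<integral>\<^sup>+x. ennreal (f n x) \<partial>M)"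
    by (rule nn_integral_suminf) simp
  also have "\<dots> = (\<Sum>n. ennreal (\<integral>x. f n x \<partial>M))"
    using int nonneg by (simp add: nn_integral_eq_integral)
  also have "\<dots> < \<infinity>"
    using sum nonneg by (simp add: suminf_ennreal2 integral_nonneg_AE)
  finally have "AE x in M. (\<Sum>n. ennreal (f n x)) \<noteq> \<infinity>"
    by (intro nn_integral_PInf_AE) auto
  then show ?thesis
  proof eventually_elim
    case (elim x)
    then have "summable (\<lambda>n. f n x)"
      using nonneg by (intro summable_suminf_not_top) (auto simp: top_ennreal_def infinity_ennreal_def)
    then show ?case by (rule summable_LIMSEQ_zero)
  qed
qed

text \<open>
  The averages have variance of order \<open>1 / n\<close>, which is summable along the squares.
\<close>

lemma strong_law_nonneg:
  fixes Y :: "nat \<Rightarrow> 'a \<Rightarrow> real"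
  assumes P: "prob_space M"
    and meas [measurable]: "\<And>i. Y i \<in> borel_measurable M" and nonneg: "\<And>i \<omega>. 0 \<le> Y i \<omega>"
    and int: "\<And>i. integrable M (\<lambda>\<omega>. (Y i \<omega>)\<^sup>2)"
    and mean: "\<And>i. (\<integral>\<omega>. Y i \<omega> \<partial>M) = m" and sq: "\<And>i. (\<integral>\<omega>. (Y i \<omega>)\<^sup>2 \<partial>M) = v"
    and prod: "\<And>i j. i \<noteq> j \<Longrightarrow> (\<integral>\<omega>. Y i \<omega> * Y j \<omega> \<partial>M) = m * m"
    and prod_int: "\<And>i j. i \<noteq> j \<Longrightarrow> integrable M (\<lambda>\<omega>. Y i \<omega> * Y j \<omega>)"
  shows "AE \<omega> in M. (\<lambda>n. (\<Sum>i<n. Y i \<omega>) / real n) \<longlonglongrightarrow> m"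
proof -
  interpret prob_space M by fact
  have int1: "integrable M (Y i)" for i
    by (rule square_integrable_imp_integrable) (use int in auto)
  define Z where "Z i \<omega> = Y i \<omega> - m" for i \<omega>
  have Z2: "(Z i \<omega>)\<^sup>2 = (Y i \<omega>)\<^sup>2 - 2 * m * Y i \<omega> + m\<^sup>2" for i \<omega>
    by (simp add: Z_def power2_diff)
  have Z_sq: "integrable M (\<lambda>\<omega>. (Z i \<omega>)\<^sup>2)" "(\<integral>\<omega>. (Z i \<omega>)\<^sup>2 \<partial>M) = v - m\<^sup>2" for i
    unfolding Z2 using int int1 mean sq by (simp_all add: prob_space power2_eq_square)
  have Zp: "Z i \<omega> * Z j \<omega> = Y i \<omega> * Y j \<omega> - m * Y i \<omega> - m * Y j \<omega> + m * m" for i j \<omega>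
    by (simp add: Z_def algebra_simps)
  have Z_uncorr: "(\<integral>\<omega>. Z i \<omega> * Z j \<omega> \<partial>M) = 0" if "i \<noteq> j" for i j
    unfolding Zp using int1 mean prod[OF that] prod_int[OF that] by (simp add: prob_space)
  have Z_m: "Z i \<in> borel_measurable M" for i unfolding Z_def by measurable
  define D where "D k \<omega> = ((\<Sum>i<k\<^sup>2. Z i \<omega>) / real (k\<^sup>2))\<^sup>2" for k \<omega>
  have var: "integrable M (\<lambda>\<omega>. (\<Sum>i<n. Z i \<omega>)\<^sup>2)" "(\<integral>\<omega>. (\<Sum>i<n. Z i \<omega>)\<^sup>2 \<partial>M) = real n * (v - m\<^sup>2)" for n
    using second_moment_sum_uncorrelated[of "{..<n}" Z M] Z_m Z_sq Z_uncorr by auto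
  have D_int: "integrable M (D k)" for k
    unfolding D_def power_divide using var by simp
  have D_mean: "(\<integral>\<omega>. D k \<omega> \<partial>M) = (v - m\<^sup>2) * (1 / real k ^ 2)" for k
    unfolding D_def power_divide using var(2)[of "k\<^sup>2"]
    by (cases "k = 0") (simp_all add: field_simps power2_eq_square)
  have "AE \<omega> in M. (\<lambda>k. D k \<omega>) \<longlonglongrightarrow> 0"
  proof (rule AE_tendsto_0_of_summable_integrals[OF D_int])
    show "summable (\<lambda>k. \<integral>\<omega>. D k \<omega> \<partial>M)"
      unfolding D_mean using inverse_power_summable[of 2, where 'a=real]
      by (intro summable_mult) (simp add: inverse_eq_divide power_one_over)
  qed (simp add: D_def)
  then show ?thesis
  proof eventually_elim
    case (elim \<omega>)
    have "(\<lambda>k. sqrt (D k \<omega>)) \<longlonglongrightarrow> sqrt 0" by (intro tendsto_intros elim)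
    then have "(\<lambda>k. (\<Sum>i<k\<^sup>2. Z i \<omega>) / real (k\<^sup>2)) \<longlonglongrightarrow> 0"
      unfolding D_def by (simp only: real_sqrt_abs real_sqrt_zero tendsto_rabs_zero_iff)
    then have lim: "(\<lambda>k. (\<Sum>i<k\<^sup>2. Z i \<omega>) / real (k\<^sup>2) + m) \<longlonglongrightarrow> 0 + m"
      by (intro tendsto_intros)
    have "\<forall>\<^sub>F k in sequentially. (\<Sum>i<k\<^sup>2. Z i \<omega>) / real (k\<^sup>2) + m = (\<Sum>i<k\<^sup>2. Y i \<omega>) / real (k\<^sup>2)"
      by (rule eventually_sequentiallyI[of 1]) (simp add: Z_def sum_subtractf field_simps)
    from Lim_transform_eventually[OF lim this]
    have "(\<lambda>k. (\<Sum>i<k\<^sup>2. Y i \<omega>) / real (k\<^sup>2)) \<longlonglongrightarrow> m" by simp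
    then show ?case by (rule mean_tendsto_from_squares[rotated]) (rule nonneg)
  qed
qed

section \<open>Integration by parts against the density\<close>

text \<open>
  Averaging \<open>F (x + 1) - F x\<close>, the integral of \<open>F'\<close> over a window of length \<open>1\<close>, over all \<open>x\<close> gives
  \<open>0\<close> by translation invariance and the integral of \<open>F'\<close> by Fubini, so limits of \<open>F\<close> at infinity
  need not be discussed.
\<close>

lemma integral_derivative_eq_0:
  fixes F F' :: "real \<Rightarrow> real"
  assumes F: "\<And>x. (F has_real_derivative F' x) (at x)"
    and int: "integrable lborel F" and int': "integrable lborel F'"
  shows "(\<integral>x. F' x \<partial>lborel) = 0"
proof -
  have [measurable]: "F' \<in> borel_measurable borel" using int' by auto
  define w :: "real \<Rightarrow> real" where "w = indicator {0..1}"
  have w [measurable]: "w \<in> borel_measurable borel" unfolding w_def by simp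
  have w_int: "integrable lborel w" "(\<integral>t. w t \<partial>lborel) = 1" unfolding w_def by simp_all
  have shift_int: "integrable lborel (\<lambda>x. f (x + t))" and shift_eq: "(\<integral>x. f (x + t) \<partial>lborel) = (\<integral>x. f x \<partial>lborel)"
    if "integrable lborel f" for f :: "real \<Rightarrow> real" and t
    using lborel_integrable_real_affine[OF that, of 1 t] lborel_integral_real_affine[of 1 f t]
    by (simp_all add: add.commute)
  have window: "(\<integral>t. w t * F' (x + t) \<partial>lborel) = F (x + 1) - F x" for x
  proof -
    have "set_integrable lborel {0..1} (\<lambda>t. F' (x + t))"
      unfolding set_integrable_def using shift_int[OF int', of x]
      by (intro integrable_mult_indicator) (auto simp: add.commute)
    from set_borel_integral_eq_integral(2)[OF this]
    have "(\<integral>t. w t * F' (x + t) \<partial>lborel) = integral {0..1} (\<lambda>t. F' (x + t))"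
      by (simp add: set_lebesgue_integral_def w_def)
    also have "((\<lambda>t. F' (x + t)) has_integral (F (x + 1) - F (x + 0))) {0..1}"
    proof (rule fundamental_theorem_of_calculus)
      fix t :: real
      have "((\<lambda>t. F (x + t)) has_real_derivative F' (x + t)) (at t)"
        using F[of "t + x"] DERIV_shift[of F "F' (t + x)" t x] by (simp add: add.commute)
      then show "((\<lambda>t. F (x + t)) has_vector_derivative F' (x + t)) (at t within {0..1})"
        by (simp add: has_real_derivative_iff_has_vector_derivative has_vector_derivative_at_within)
    qed simp
    then have "integral {0..1} (\<lambda>t. F' (x + t)) = F (x + 1) - F x" by (simp add: integral_unique)
    finally show ?thesis .
  qed
  have pair: "integrable (lborel \<Otimes>\<^sub>M lborel) (\<lambda>(t, x). w t * F' (x + t))"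
  proof (rule lborel_pair.Fubini_integrable)
    have "(\<integral>x. norm (w t * F' (x + t)) \<partial>lborel) = w t * (\<integral>x. \<bar>F' x\<bar> \<partial>lborel)" for t
      using shift_eq[of "\<lambda>x. \<bar>F' x\<bar>" t] int' by (simp add: abs_mult w_def)
    then show "integrable lborel (\<lambda>t. \<integral>x. norm (case (t, x) of (t, x) \<Rightarrow> w t * F' (x + t)) \<partial>lborel)"
      using w_int by simp
    show "AE t in lborel. integrable lborel (\<lambda>x. case (t, x) of (t, x) \<Rightarrow> w t * F' (x + t))"
      using shift_int[OF int'] by simp
  qed measurable
  have "(\<integral>x. F' x \<partial>lborel) = (\<integral>t. w t * (\<integral>x. F' x \<partial>lborel) \<partial>lborel)"
    using w_int by simp
  also have "\<dots> = (\<integral>t. (\<integral>x. w t * F' (x + t) \<partial>lborel) \<partial>lborel)"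
    using shift_eq[OF int'] by simp
  also have "\<dots> = (\<integral>x. (\<integral>t. w t * F' (x + t) \<partial>lborel) \<partial>lborel)"
    using lborel_pair.Fubini_integral[OF pair] by simp
  also have "\<dots> = (\<integral>x. F (x + 1) \<partial>lborel) - (\<integral>x. F x \<partial>lborel)"
    unfolding window using shift_int[OF int, of 1] int by simp
  also have "\<dots> = 0" using shift_eq[OF int, of 1] by simp
  finally show ?thesis .
qed

lemma sets_dens_law [simp, measurable_cong]: "sets (dens_law \<pi>) = sets borel"
  by (simp add: dens_law_def)

lemma space_dens_law [simp]: "space (dens_law \<pi>) = UNIV"
  by (simp add: dens_law_def)

locale regular_target =
  fixes \<pi> :: "real \<Rightarrow> real"
  assumes density: "positive_prob_density \<pi>" and regular: "regular_density \<pi>"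
begin

abbreviation log_density :: "real \<Rightarrow> real" where
  "log_density \<equiv> \<lambda>x. ln (\<pi> x)"

lemma pos: "0 < \<pi> x" and measurable_density [measurable]: "\<pi> \<in> borel_measurable borel"
  using density by (auto simp: positive_prob_density_def)

sublocale prob_space "dens_law \<pi>"
  using density by (simp add: positive_prob_density_def)

lemma diff3: "thrice_differentiable log_density"
  using regular by (simp add: regular_density_def)

lemma score_eq: "score \<pi> = (deriv ^^ 1) log_density"
  by (simp add: score_def)

lemma DERIV_log_density: "(log_density has_real_derivative score \<pi> x) (at x)"
  using thrice_differentiable_derivs[OF diff3, of 0 x] by (simp add: score_eq)

lemma DERIV_score: "(score \<pi> has_real_derivative (deriv ^^ 2) log_density x) (at x)"
  using thrice_differentiable_derivs[OF diff3, of 1 x] by (simp add: score_eq numeral_2_eq_2)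

lemma measurable_score [measurable]: "score \<pi> \<in> borel_measurable borel"
  using thrice_differentiable_continuous[OF diff3, of 1]
  by (simp add: score_eq borel_measurable_continuous_onI)

lemma measurable_deriv2 [measurable]: "(deriv ^^ 2) log_density \<in> borel_measurable borel"
  using thrice_differentiable_continuous[OF diff3, of 2] by (simp add: borel_measurable_continuous_onI)

lemma derivs_bounded:
  obtains K where "\<And>x. \<bar>(deriv ^^ 2) log_density x\<bar> \<le> K" "\<And>x. \<bar>(deriv ^^ 3) log_density x\<bar> \<le> K"
proof -
  obtain K2 K3 where "\<And>x. \<bar>(deriv ^^ 2) log_density x\<bar> \<le> K2" "\<And>x. \<bar>(deriv ^^ 3) log_density x\<bar> \<le> K3"
    using regular unfolding regular_density_def bounded_iff by auto
  then show ?thesis by (intro that[of "max K2 K3"]) (simp_all add: le_max_iff_disj)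
qed

lemma integrable_score_sq: "integrable (dens_law \<pi>) (\<lambda>x. (score \<pi> x)\<^sup>2)"
  using regular by (simp add: regular_density_def)

lemma integrable_score: "integrable (dens_law \<pi>) (score \<pi>)"
  by (rule square_integrable_imp_integrable) (use integrable_score_sq in auto)

text \<open>
  Integration by parts: the integrand, multiplied by \<open>\<pi>\<close>, is the derivative of \<open>\<pi> * g\<close>.
\<close>

lemma stein_identity:
  assumes g: "\<And>x. (g has_real_derivative g' x) (at x)"
    and int: "integrable (dens_law \<pi>) g" and int': "integrable (dens_law \<pi>) (\<lambda>x. g' x + g x * score \<pi> x)"
  shows "(\<integral>x. g' x + g x * score \<pi> x \<partial>dens_law \<pi>) = 0"
proof -
  have [measurable]: "g \<in> borel_measurable borel" "(\<lambda>x. g' x + g x * score \<pi> x) \<in> borel_measurable borel"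
    using borel_measurable_integrable[OF int] borel_measurable_integrable[OF int'] by simp_all
  have "(\<integral>x. \<pi> x * (g' x + g x * score \<pi> x) \<partial>lborel) = 0"
  proof (rule integral_derivative_eq_0[where F="\<lambda>x. \<pi> x * g x"])
    fix x
    have "((\<lambda>x. exp (ln (\<pi> x))) has_real_derivative exp (ln (\<pi> x)) * score \<pi> x) (at x)"
      by (rule DERIV_fun_exp[OF DERIV_log_density])
    then have "(\<pi> has_real_derivative \<pi> x * score \<pi> x) (at x)" using pos by simp
    from DERIV_mult[OF this g]
    show "((\<lambda>x. \<pi> x * g x) has_real_derivative \<pi> x * (g' x + g x * score \<pi> x)) (at x)"
      by (simp add: algebra_simps)
  next
    show "integrable lborel (\<lambda>x. \<pi> x * g x)" "integrable lborel (\<lambda>x. \<pi> x * (g' x + g x * score \<pi> x))"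
      using int int' pos unfolding dens_law_def by (simp_all add: integrable_density less_imp_le)
  qed
  then show ?thesis
    unfolding dens_law_def using pos by (simp add: integral_density less_imp_le)
qed

lemma integral_deriv2_log_density: "(\<integral>x. (deriv ^^ 2) log_density x \<partial>dens_law \<pi>) = - (info \<pi>)\<^sup>2"
proof -
  obtain K where K: "\<And>x. \<bar>(deriv ^^ 2) log_density x\<bar> \<le> K" using derivs_bounded by blast
  have int2: "integrable (dens_law \<pi>) ((deriv ^^ 2) log_density)"
    by (rule integrable_const_bound[of _ K]) (use K in auto)
  have "(\<integral>x. (deriv ^^ 2) log_density x + score \<pi> x * score \<pi> x \<partial>dens_law \<pi>) = 0"
    by (rule stein_identity[OF DERIV_score integrable_score])
       (use int2 integrable_score_sq in \<open>simp add: power2_eq_square\<close>)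
  then have "(\<integral>x. (deriv ^^ 2) log_density x \<partial>dens_law \<pi>) + (\<integral>x. (score \<pi> x)\<^sup>2 \<partial>dens_law \<pi>) = 0"
    using int2 integrable_score_sq by (simp add: power2_eq_square)
  then show ?thesis by (simp add: info_def)
qed

text \<open>
  A vanishing score would contradict the integration by parts formula for \<open>arctan\<close>, whose
  derivative is positive everywhere.
\<close>

lemma info_pos: "0 < info \<pi>"
proof (rule ccontr)
  assume "\<not> 0 < info \<pi>"
  then have "(\<integral>x. (score \<pi> x)\<^sup>2 \<partial>dens_law \<pi>) = 0" by (simp add: info_def order.antisym)
  then have AE0: "AE x in dens_law \<pi>. score \<pi> x = 0"
    using integral_nonneg_eq_0_iff_AE[OF integrable_score_sq] by simp
  have int: "integrable (dens_law \<pi>) (\<lambda>x. inverse (1 + x\<^sup>2))"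
    by (rule integrable_const_bound[of _ 1]) (auto simp: inverse_le_1_iff)
  have "\<bar>arctan x\<bar> \<le> pi / 2" for x using arctan_bounded[of x] by linarith
  then have arctan: "integrable (dens_law \<pi>) arctan"
    by (intro integrable_const_bound[of _ "pi / 2"])
       (auto intro!: AE_I2 borel_measurable_continuous_onI continuous_intros)
  have eq: "AE x in dens_law \<pi>. inverse (1 + x\<^sup>2) + arctan x * score \<pi> x = inverse (1 + x\<^sup>2)"
    using AE0 by eventually_elim simp
  have m: "(\<lambda>x. arctan x) \<in> borel_measurable borel"
    by (intro borel_measurable_continuous_onI continuous_intros)
  have int': "integrable (dens_law \<pi>) (\<lambda>x. inverse (1 + x\<^sup>2) + arctan x * score \<pi> x)"
    by (subst integrable_cong_AE[OF _ _ eq]) (use int m in auto)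
  have "(\<integral>x. inverse (1 + x\<^sup>2) \<partial>dens_law \<pi>) = (\<integral>x. inverse (1 + x\<^sup>2) + arctan x * score \<pi> x \<partial>dens_law \<pi>)"
    by (subst integral_cong_AE[OF _ _ eq]) (use m in auto)
  also have "\<dots> = 0" by (rule stein_identity[OF DERIV_arctan arctan int'])
  finally have "AE x in dens_law \<pi>. inverse (1 + x\<^sup>2) = 0"
    using integral_nonneg_eq_0_iff_AE[OF int] by simp
  moreover have "inverse (1 + x\<^sup>2) \<noteq> 0" for x :: real
    by (metis add_nonneg_eq_0_iff inverse_nonzero_iff_nonzero zero_le_one zero_le_power2 zero_neq_one)
  ultimately have "AE x in dens_law \<pi>. False" by simp
  then show False by simp
qed

text \<open>
  Integration by parts for the truncations \<open>s\<^sup>3 / (1 + e s\<^sup>2)\<close> of the cubed score \<open>s\<close> bounds the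
  mean of \<open>s\<^sup>4 / (1 + e s\<^sup>2)\<close> uniformly in \<open>e\<close>, since the derivative of the score is bounded;
  Fatou's lemma removes the truncation.
\<close>

lemma integrable_score_pow4: "integrable (dens_law \<pi>) (\<lambda>x. (score \<pi> x) ^ 4)"
proof -
  obtain K where K: "\<And>x. \<bar>(deriv ^^ 2) log_density x\<bar> \<le> K" using derivs_bounded by blast
  then have "0 \<le> K" by (meson abs_ge_zero order_trans)
  let ?s = "score \<pi>" and ?C = "3 * K * (\<integral>x. (score \<pi> x)\<^sup>2 \<partial>dens_law \<pi>)"
  have trunc: "integrable (dens_law \<pi>) (\<lambda>x. (?s x) ^ 4 / (1 + e * (?s x)\<^sup>2))"
    "(\<integral>x. (?s x) ^ 4 / (1 + e * (?s x)\<^sup>2) \<partial>dens_law \<pi>) \<le> ?C" if "e > 0" for e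
  proof -
    define h where "h t = t ^ 3 / (1 + e * t\<^sup>2)" for t :: real
    define h' where "h' t = (3 * t\<^sup>2 + e * t ^ 4) / (1 + e * t\<^sup>2)\<^sup>2" for t :: real
    have den: "1 + e * t\<^sup>2 \<ge> 1" for t :: real using \<open>e > 0\<close> by simp
    have den0: "1 + e * t\<^sup>2 \<noteq> 0" for t :: real using den[of t] by linarith
    have DERIV_h: "(h has_real_derivative h' t) (at t)" for t
      unfolding h_def h'_def
      by (rule derivative_eq_intros refl den0)+ (simp add: power2_eq_square eval_nat_numeral algebra_simps)
    have abs_h': "\<bar>h' t\<bar> \<le> 3 * t\<^sup>2" for t
    proof -
      have "3 * t\<^sup>2 + e * t ^ 4 \<le> 3 * t\<^sup>2 * (1 + e * t\<^sup>2)\<^sup>2"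
      proof -
        have "3 * t\<^sup>2 * (1 + e * t\<^sup>2)\<^sup>2 = 3 * t\<^sup>2 + e * t ^ 4 + (5 * (e * t ^ 4) + 3 * (e\<^sup>2 * t ^ 6))"
          by (simp add: power2_eq_square eval_nat_numeral algebra_simps)
        moreover have "0 \<le> 5 * (e * t ^ 4) + 3 * (e\<^sup>2 * t ^ 6)"
          using \<open>e > 0\<close> by (intro add_nonneg_nonneg mult_nonneg_nonneg) auto
        ultimately show ?thesis by linarith
      qed
      moreover have "0 < (1 + e * t\<^sup>2)\<^sup>2" using den0 by simp
      moreover have "0 \<le> 3 * t\<^sup>2 + e * t ^ 4" using \<open>e > 0\<close> by simp
      ultimately show ?thesis unfolding h'_def by (simp add: pos_divide_le_eq abs_of_nonneg)
    qed
    have sq_le: "t\<^sup>2 / (1 + e * t\<^sup>2) \<le> 1 / e" for t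
    proof -
      have "t\<^sup>2 \<le> 1 / e * (1 + e * t\<^sup>2)" using \<open>e > 0\<close> by (simp add: distrib_left)
      moreover have "0 < 1 + e * t\<^sup>2" using den[of t] by linarith
      ultimately show ?thesis by (simp only: pos_divide_le_eq)
    qed
    have abs_h: "\<bar>h t\<bar> \<le> 1 / e * \<bar>t\<bar>" for t
    proof -
      have "\<bar>h t\<bar> = t\<^sup>2 / (1 + e * t\<^sup>2) * \<bar>t\<bar>"
        using den[of t] by (simp add: h_def abs_mult power_abs[symmetric] eval_nat_numeral)
      then show ?thesis using mult_right_mono[OF sq_le[of t], of "\<bar>t\<bar>"] by simp
    qed
    have h_t: "h t * t = t ^ 4 / (1 + e * t\<^sup>2)" for t by (simp add: h_def eval_nat_numeral)
    have [measurable]: "h \<in> borel_measurable borel" "h' \<in> borel_measurable borel"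
      unfolding h_def h'_def by measurable
    have int_h: "integrable (dens_law \<pi>) (\<lambda>x. h (?s x))"
      by (rule Bochner_Integration.integrable_bound[where f="\<lambda>x. 1 / e * ?s x"])
         (use integrable_score abs_h \<open>e > 0\<close> in \<open>auto simp: abs_mult\<close>)
    have abs_g': "\<bar>h' (?s x) * (deriv ^^ 2) log_density x\<bar> \<le> 3 * K * (?s x)\<^sup>2" for x
    proof -
      have "\<bar>h' (?s x)\<bar> * \<bar>(deriv ^^ 2) log_density x\<bar> \<le> 3 * (?s x)\<^sup>2 * K"
        by (intro mult_mono abs_h' K) auto
      then show ?thesis by (simp add: abs_mult mult_ac)
    qed
    have int_g': "integrable (dens_law \<pi>) (\<lambda>x. h' (?s x) * (deriv ^^ 2) log_density x)"
      by (rule Bochner_Integration.integrable_bound[where f="\<lambda>x. 3 * K * (?s x)\<^sup>2"])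
         (use integrable_score_sq abs_g' \<open>0 \<le> K\<close> in \<open>auto simp: abs_mult\<close>)
    have int_hs: "integrable (dens_law \<pi>) (\<lambda>x. h (?s x) * ?s x)"
    proof (rule Bochner_Integration.integrable_bound[where f="\<lambda>x. 1 / e * (?s x)\<^sup>2"])
      have "\<bar>h (?s x)\<bar> * \<bar>?s x\<bar> \<le> 1 / e * \<bar>?s x\<bar> * \<bar>?s x\<bar>" for x
        by (intro mult_right_mono abs_h) auto
      then show "AE x in dens_law \<pi>. norm (h (?s x) * ?s x) \<le> norm (1 / e * (?s x)\<^sup>2)"
        using \<open>e > 0\<close> by (auto simp: abs_mult power2_eq_square)
    qed (use integrable_score_sq in auto)
    show "integrable (dens_law \<pi>) (\<lambda>x. (?s x) ^ 4 / (1 + e * (?s x)\<^sup>2))"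
      using int_hs unfolding h_t .
    have "(\<integral>x. h' (?s x) * (deriv ^^ 2) log_density x + h (?s x) * ?s x \<partial>dens_law \<pi>) = 0"
      by (rule stein_identity[OF DERIV_chain2[OF DERIV_h DERIV_score] int_h])
         (intro Bochner_Integration.integrable_add int_g' int_hs)
    then have "(\<integral>x. h (?s x) * ?s x \<partial>dens_law \<pi>) = - (\<integral>x. h' (?s x) * (deriv ^^ 2) log_density x \<partial>dens_law \<pi>)"
      using int_g' int_hs by simp
    also have "\<dots> \<le> \<bar>\<integral>x. h' (?s x) * (deriv ^^ 2) log_density x \<partial>dens_law \<pi>\<bar>" by simp
    also have "\<dots> \<le> (\<integral>x. \<bar>h' (?s x) * (deriv ^^ 2) log_density x\<bar> \<partial>dens_law \<pi>)" by (rule integral_abs_bound)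
    also have "\<dots> \<le> (\<integral>x. 3 * K * (?s x)\<^sup>2 \<partial>dens_law \<pi>)"
      using int_g' integrable_score_sq abs_g' by (intro integral_mono) auto
    also have "\<dots> = ?C" by simp
    finally show "(\<integral>x. (?s x) ^ 4 / (1 + e * (?s x)\<^sup>2) \<partial>dens_law \<pi>) \<le> ?C" unfolding h_t .
  qed
  define u where "u n x = (?s x) ^ 4 / (1 + 1 / real (Suc n) * (?s x)\<^sup>2)" for n x
  have u0: "0 \<le> u n x" for n x unfolding u_def by (intro divide_nonneg_nonneg add_nonneg_nonneg) auto
  have [measurable]: "u n \<in> borel_measurable borel" for n unfolding u_def by measurable
  have "(\<lambda>n. u n x) \<longlonglongrightarrow> (?s x) ^ 4 / (1 + 0 * (?s x)\<^sup>2)" for x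
    unfolding u_def by (intro tendsto_intros LIMSEQ_Suc[OF lim_1_over_n]) auto
  then have "(\<lambda>n. ennreal (u n x)) \<longlonglongrightarrow> ennreal ((?s x) ^ 4)" for x
    by (intro tendsto_ennrealI) simp
  then have "(\<integral>\<^sup>+x. ennreal ((?s x) ^ 4) \<partial>dens_law \<pi>) = (\<integral>\<^sup>+x. liminf (\<lambda>n. ennreal (u n x)) \<partial>dens_law \<pi>)"
    by (intro nn_integral_cong lim_imp_Liminf[symmetric]) auto
  also have "\<dots> \<le> liminf (\<lambda>n. \<integral>\<^sup>+x. ennreal (u n x) \<partial>dens_law \<pi>)"
    by (rule nn_integral_liminf) simp
  also have "\<dots> \<le> liminf (\<lambda>n :: nat. ennreal ?C)"
  proof (rule Liminf_mono, rule always_eventually, rule allI)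
    fix n
    have "(\<integral>\<^sup>+x. ennreal (u n x) \<partial>dens_law \<pi>) = ennreal (\<integral>x. u n x \<partial>dens_law \<pi>)"
      by (rule nn_integral_eq_integral) (use trunc(1)[of "1 / real (Suc n)"] u0 in \<open>auto simp: u_def\<close>)
    also have "\<dots> \<le> ennreal ?C"
      using trunc(2)[of "1 / real (Suc n)"] by (intro ennreal_leI) (simp add: u_def)
    finally show "(\<integral>\<^sup>+x. ennreal (u n x) \<partial>dens_law \<pi>) \<le> ennreal ?C" .
  qed
  also have "\<dots> = ennreal ?C" by (simp add: Liminf_const)
  finally have "(\<integral>\<^sup>+x. ennreal ((?s x) ^ 4) \<partial>dens_law \<pi>) < \<infinity>"
    by (rule order.strict_trans1) simp
  then show ?thesis by (intro integrableI_nonneg) auto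
qed

end

section \<open>Averages along two independent sequences\<close>

lemma nn_integral_pair_mult:
  assumes "sigma_finite_measure N"
    and [measurable]: "u \<in> borel_measurable M" "v \<in> borel_measurable N"
  shows "(\<integral>\<^sup>+z. u (fst z) * v (snd z) \<partial>(M \<Otimes>\<^sub>M N)) = (\<integral>\<^sup>+x. u x \<partial>M) * (\<integral>\<^sup>+y. v y \<partial>N)"
proof -
  interpret sigma_finite_measure N by fact
  have "(\<integral>\<^sup>+z. u (fst z) * v (snd z) \<partial>(M \<Otimes>\<^sub>M N)) = (\<integral>\<^sup>+x. \<integral>\<^sup>+y. u x * v y \<partial>N \<partial>M)"
    by (subst nn_integral_fst[symmetric]) simp_all
  then show ?thesis by (simp add: nn_integral_cmult nn_integral_multc)
qed

lemma integral_pair_fst: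
  fixes g :: "'a \<Rightarrow> real"
  assumes "prob_space N" and g: "g \<in> borel_measurable M"
  shows "integrable (M \<Otimes>\<^sub>M N) (\<lambda>z. g (fst z)) \<longleftrightarrow> integrable M g"
    and "(\<integral>z. g (fst z) \<partial>(M \<Otimes>\<^sub>M N)) = (\<integral>x. g x \<partial>M)"
  using integrable_distr_eq[OF measurable_fst g, of N] integral_distr[OF measurable_fst g, of N]
  by (simp_all add: prob_space.distr_pair_fst[OF assms(1)])

locale paired_sequences = prob_space M for M :: "'w measure" +
  fixes A B :: "'a measure" and P Q X \<Gamma>
  assumes indep_X: "indep_vars (\<lambda>_. A) X (UNIV :: nat set)" and law_X: "\<And>i. distr M A (X i) = P"
    and indep_\<Gamma>: "indep_vars (\<lambda>_. B) \<Gamma> (UNIV :: nat set)" and law_\<Gamma>: "\<And>i. distr M B (\<Gamma> i) = Q"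
    and indep: "indep_var (\<Pi>\<^sub>M i\<in>UNIV. A) (\<lambda>\<omega> i. X i \<omega>) (\<Pi>\<^sub>M i\<in>UNIV. B) (\<lambda>\<omega> i. \<Gamma> i \<omega>)"
begin

lemma X_measurable [measurable]: "X i \<in> M \<rightarrow>\<^sub>M A" and \<Gamma>_measurable [measurable]: "\<Gamma> i \<in> M \<rightarrow>\<^sub>M B"
  using indep_X indep_\<Gamma> by (auto simp: indep_vars_def)

lemma sets_laws [measurable_cong]: "sets P = sets A" "sets Q = sets B"
  using law_X[of 0] law_\<Gamma>[of 0] by (metis sets_distr)+

lemma prob_laws: "prob_space P" "prob_space Q"
  using prob_space_distr[OF X_measurable, of 0] prob_space_distr[OF \<Gamma>_measurable, of 0] law_X law_\<Gamma> by simp_all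

lemma prob_pair: "prob_space (P \<Otimes>\<^sub>M Q)"
proof -
  interpret p: prob_space P by (rule prob_laws)
  interpret q: prob_space Q by (rule prob_laws)
  interpret pair_prob_space P Q ..
  show ?thesis by (rule P.prob_space_axioms)
qed

lemma law_pair: "distr M (A \<Otimes>\<^sub>M B) (\<lambda>\<omega>. (X i \<omega>, \<Gamma> i \<omega>)) = P \<Otimes>\<^sub>M Q"
proof -
  have "indep_var A ((\<lambda>x. x i) \<circ> (\<lambda>\<omega> i. X i \<omega>)) B ((\<lambda>x. x i) \<circ> (\<lambda>\<omega> i. \<Gamma> i \<omega>))"
    by (rule indep_var_compose[OF indep]) measurable
  then show ?thesis
    unfolding indep_var_distribution_eq comp_def by (simp add: law_X law_\<Gamma>)
qed

lemma law_two_pairs: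
  assumes "i \<noteq> j"
  shows "distr M ((A \<Otimes>\<^sub>M A) \<Otimes>\<^sub>M (B \<Otimes>\<^sub>M B)) (\<lambda>\<omega>. ((X i \<omega>, X j \<omega>), (\<Gamma> i \<omega>, \<Gamma> j \<omega>)))
    = (P \<Otimes>\<^sub>M P) \<Otimes>\<^sub>M (Q \<Otimes>\<^sub>M Q)"
proof -
  have "indep_var (A \<Otimes>\<^sub>M A) ((\<lambda>x. (x i, x j)) \<circ> (\<lambda>\<omega> i. X i \<omega>)) (B \<Otimes>\<^sub>M B) ((\<lambda>x. (x i, x j)) \<circ> (\<lambda>\<omega> i. \<Gamma> i \<omega>))"
    by (rule indep_var_compose[OF indep]) measurable
  moreover have "indep_var A (X i) A (X j)" "indep_var B (\<Gamma> i) B (\<Gamma> j)"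
    using indep_vars_imp_indep_var[OF indep_X _ _ assms] indep_vars_imp_indep_var[OF indep_\<Gamma> _ _ assms] by auto
  ultimately show ?thesis
    unfolding indep_var_distribution_eq comp_def by (simp add: law_X law_\<Gamma>)
qed

text \<open>
  The two pairs are regrouped as a pair of \<open>X\<close> values and a pair of \<open>\<Gamma>\<close> values, whose joint law is a
  product. Working with nonnegative integrands leaves no integrability to be checked.
\<close>

lemma nn_integral_product:
  assumes [measurable]: "f \<in> borel_measurable (A \<Otimes>\<^sub>M B)" and "i \<noteq> j"
  shows "(\<integral>\<^sup>+\<omega>. f (X i \<omega>, \<Gamma> i \<omega>) * f (X j \<omega>, \<Gamma> j \<omega>) \<partial>M)
    = (\<integral>\<^sup>+z. f z \<partial>(P \<Otimes>\<^sub>M Q)) * (\<integral>\<^sup>+z. f z \<partial>(P \<Otimes>\<^sub>M Q))"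
proof -
  interpret P: prob_space P by (rule prob_laws)
  interpret Q: prob_space Q by (rule prob_laws)
  interpret QQ: pair_prob_space Q Q ..
  define g where "g z = f (fst (fst z), fst (snd z)) * f (snd (fst z), snd (snd z))" for z
  have g [measurable]: "g \<in> borel_measurable ((A \<Otimes>\<^sub>M A) \<Otimes>\<^sub>M (B \<Otimes>\<^sub>M B))"
    unfolding g_def by measurable
  define h where "h x = (\<integral>\<^sup>+y. f (x, y) \<partial>Q)" for x
  have h [measurable]: "h \<in> borel_measurable P" unfolding h_def by measurable
  have "(\<integral>\<^sup>+\<omega>. f (X i \<omega>, \<Gamma> i \<omega>) * f (X j \<omega>, \<Gamma> j \<omega>) \<partial>M)
      = (\<integral>\<^sup>+z. g z \<partial>distr M ((A \<Otimes>\<^sub>M A) \<Otimes>\<^sub>M (B \<Otimes>\<^sub>M B)) (\<lambda>\<omega>. ((X i \<omega>, X j \<omega>), (\<Gamma> i \<omega>, \<Gamma> j \<omega>))))"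
    by (subst nn_integral_distr) (simp_all add: g_def)
  also have "\<dots> = (\<integral>\<^sup>+z. g z \<partial>((P \<Otimes>\<^sub>M P) \<Otimes>\<^sub>M (Q \<Otimes>\<^sub>M Q)))"
    unfolding law_two_pairs[OF assms(2)] ..
  also have "\<dots> = (\<integral>\<^sup>+x. \<integral>\<^sup>+y. g (x, y) \<partial>(Q \<Otimes>\<^sub>M Q) \<partial>(P \<Otimes>\<^sub>M P))"
    by (rule QQ.nn_integral_fst[symmetric]) measurable
  also have "\<dots> = (\<integral>\<^sup>+x. h (fst x) * h (snd x) \<partial>(P \<Otimes>\<^sub>M P))"
  proof (rule nn_integral_cong)
    fix x assume "x \<in> space (P \<Otimes>\<^sub>M P)"
    then have [measurable]: "fst x \<in> space A" "snd x \<in> space A"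
      unfolding space_pair_measure sets_eq_imp_space_eq[OF sets_laws(1)] by (simp_all add: mem_Times_iff)
    have "(\<integral>\<^sup>+y. g (x, y) \<partial>(Q \<Otimes>\<^sub>M Q)) = (\<integral>\<^sup>+y. f (fst x, fst y) * f (snd x, snd y) \<partial>(Q \<Otimes>\<^sub>M Q))"
      by (simp add: g_def case_prod_beta)
    also have "\<dots> = h (fst x) * h (snd x)"
      unfolding h_def by (rule nn_integral_pair_mult) (unfold_locales, measurable)
    finally show "(\<integral>\<^sup>+y. g (x, y) \<partial>(Q \<Otimes>\<^sub>M Q)) = h (fst x) * h (snd x)" .
  qed
  also have "\<dots> = (\<integral>\<^sup>+x. h x \<partial>P) * (\<integral>\<^sup>+x. h x \<partial>P)"
    by (rule nn_integral_pair_mult) (unfold_locales, measurable)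
  also have "(\<integral>\<^sup>+x. h x \<partial>P) = (\<integral>\<^sup>+z. f z \<partial>(P \<Otimes>\<^sub>M Q))"
    unfolding h_def by (rule Q.nn_integral_fst) measurable
  finally show ?thesis .
qed


lemma strong_law_pairs_nonneg:
  fixes f :: "'a \<times> 'a \<Rightarrow> real"
  assumes f [measurable]: "f \<in> borel_measurable (A \<Otimes>\<^sub>M B)" and nonneg: "\<And>z. 0 \<le> f z"
    and sq: "integrable (P \<Otimes>\<^sub>M Q) (\<lambda>z. (f z)\<^sup>2)"
  shows "AE \<omega> in M. (\<lambda>n. (\<Sum>i<n. f (X i \<omega>, \<Gamma> i \<omega>)) / real n) \<longlonglongrightarrow> (\<integral>z. f z \<partial>(P \<Otimes>\<^sub>M Q))"
proof -
  interpret PQ: prob_space "P \<Otimes>\<^sub>M Q" by (rule prob_pair)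
  let ?m = "\<integral>z. f z \<partial>(P \<Otimes>\<^sub>M Q)" and ?Y = "\<lambda>i \<omega>. f (X i \<omega>, \<Gamma> i \<omega>)"
  have int: "integrable (P \<Otimes>\<^sub>M Q) f"
    by (rule PQ.square_integrable_imp_integrable) (use sq in auto)
  have pair [measurable]: "(\<lambda>\<omega>. (X i \<omega>, \<Gamma> i \<omega>)) \<in> M \<rightarrow>\<^sub>M A \<Otimes>\<^sub>M B" for i by measurable
  have tr: "integrable M (\<lambda>\<omega>. g (X i \<omega>, \<Gamma> i \<omega>)) \<longleftrightarrow> integrable (P \<Otimes>\<^sub>M Q) g"
    "(\<integral>\<omega>. g (X i \<omega>, \<Gamma> i \<omega>) \<partial>M) = (\<integral>z. g z \<partial>(P \<Otimes>\<^sub>M Q))"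
    if "g \<in> borel_measurable (A \<Otimes>\<^sub>M B)" for g :: "'a \<times> 'a \<Rightarrow> real" and i
    using integrable_distr_eq[OF pair that] integral_distr[OF pair that] by (simp_all add: law_pair)
  have nn: "(\<integral>\<^sup>+\<omega>. ennreal (?Y i \<omega> * ?Y j \<omega>) \<partial>M) = ennreal (?m * ?m)" if "i \<noteq> j" for i j
    using nn_integral_product[of "\<lambda>z. ennreal (f z)", OF _ that] nonneg
    by (simp add: ennreal_mult nn_integral_eq_integral[OF int] integral_nonneg_AE)
  have prod: "has_bochner_integral M (\<lambda>\<omega>. ?Y i \<omega> * ?Y j \<omega>) (?m * ?m)" if "i \<noteq> j" for i j
    by (rule has_bochner_integral_nn_integral)
       (use nonneg nn[OF that] in \<open>auto simp: integral_nonneg_AE\<close>)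
  show ?thesis
  proof (rule strong_law_nonneg)
    show "prob_space M" by unfold_locales
    show "integrable M (\<lambda>\<omega>. (?Y i \<omega>)\<^sup>2)" for i using tr(1)[of "\<lambda>z. (f z)\<^sup>2"] sq by simp
    show "(\<integral>\<omega>. ?Y i \<omega> \<partial>M) = ?m" for i by (rule tr(2)) simp
    show "(\<integral>\<omega>. (?Y i \<omega>)\<^sup>2 \<partial>M) = (\<integral>z. (f z)\<^sup>2 \<partial>(P \<Otimes>\<^sub>M Q))" for i
      by (rule tr(2)[of "\<lambda>z. (f z)\<^sup>2"]) simp
    show "(\<integral>\<omega>. ?Y i \<omega> * ?Y j \<omega> \<partial>M) = ?m * ?m" "integrable M (\<lambda>\<omega>. ?Y i \<omega> * ?Y j \<omega>)" if "i \<noteq> j" for i j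
      using prod[OF that] by (simp_all add: has_bochner_integral_iff)
  qed (use nonneg in auto)
qed

lemma strong_law_pairs:
  fixes f :: "'a \<times> 'a \<Rightarrow> real"
  assumes f [measurable]: "f \<in> borel_measurable (A \<Otimes>\<^sub>M B)" and sq: "integrable (P \<Otimes>\<^sub>M Q) (\<lambda>z. (f z)\<^sup>2)"
  shows "AE \<omega> in M. (\<lambda>n. (\<Sum>i<n. f (X i \<omega>, \<Gamma> i \<omega>)) / real n) \<longlonglongrightarrow> (\<integral>z. f z \<partial>(P \<Otimes>\<^sub>M Q))"
proof -
  interpret PQ: prob_space "P \<Otimes>\<^sub>M Q" by (rule prob_pair)
  have fPQ: "f \<in> borel_measurable (P \<Otimes>\<^sub>M Q)"
    using f by (simp add: measurable_cong_sets[OF sets_pair_measure_cong[OF sets_laws] refl])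
  let ?p = "\<lambda>z. max 0 (f z)" and ?n = "\<lambda>z. max 0 (- f z)"
  have int: "integrable (P \<Otimes>\<^sub>M Q) f"
    by (rule PQ.square_integrable_imp_integrable[OF fPQ sq])
  have max_sq: "(max 0 t)\<^sup>2 \<le> t\<^sup>2" for t :: real by (simp add: max_def)
  have p_sq: "integrable (P \<Otimes>\<^sub>M Q) (\<lambda>z. (?p z)\<^sup>2)"
    by (rule Bochner_Integration.integrable_bound[OF sq]) (use fPQ max_sq in auto)
  have n_sq: "integrable (P \<Otimes>\<^sub>M Q) (\<lambda>z. (?n z)\<^sup>2)"
    by (rule Bochner_Integration.integrable_bound[OF sq]) (use fPQ max_sq[of "- f _"] in auto)
  have p_int: "integrable (P \<Otimes>\<^sub>M Q) ?p" and n_int: "integrable (P \<Otimes>\<^sub>M Q) ?n"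
    using int by (auto intro!: integrable_max)
  have "AE \<omega> in M. (\<lambda>n. (\<Sum>i<n. ?p (X i \<omega>, \<Gamma> i \<omega>)) / real n) \<longlonglongrightarrow> (\<integral>z. ?p z \<partial>(P \<Otimes>\<^sub>M Q))"
    by (rule strong_law_pairs_nonneg[OF _ _ p_sq]) simp_all
  moreover have "AE \<omega> in M. (\<lambda>n. (\<Sum>i<n. ?n (X i \<omega>, \<Gamma> i \<omega>)) / real n) \<longlonglongrightarrow> (\<integral>z. ?n z \<partial>(P \<Otimes>\<^sub>M Q))"
    by (rule strong_law_pairs_nonneg[OF _ _ n_sq]) simp_all
  ultimately show ?thesis
  proof eventually_elim
    case (elim \<omega>)
    have "(\<integral>z. f z \<partial>(P \<Otimes>\<^sub>M Q)) = (\<integral>z. ?p z \<partial>(P \<Otimes>\<^sub>M Q)) - (\<integral>z. ?n z \<partial>(P \<Otimes>\<^sub>M Q))"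
      unfolding Bochner_Integration.integral_diff[OF p_int n_int, symmetric]
      by (rule Bochner_Integration.integral_cong) (auto simp: max_def)
    moreover have "(\<Sum>i<n. f (X i \<omega>, \<Gamma> i \<omega>)) / real n
        = (\<Sum>i<n. ?p (X i \<omega>, \<Gamma> i \<omega>)) / real n - (\<Sum>i<n. ?n (X i \<omega>, \<Gamma> i \<omega>)) / real n" for n
      unfolding diff_divide_distrib[symmetric] sum_subtractf[symmetric]
      by (intro arg_cong2[where f="(/)"] sum.cong refl) (simp add: max_def)
    ultimately show ?case using tendsto_diff[OF elim] by simp
  qed
qed

end


section \<open>Derivatives in the first argument\<close>

lemma sets_unif01 [simp, measurable_cong]: "sets unif01 = sets (restrict_space borel {0..1})"
  unfolding unif01_def by (rule sets_restrict_space_cong) simp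

lemma space_unif01 [simp]: "space unif01 = {0..1}"
  by (simp add: unif01_def)

lemma prob_space_unif01: "prob_space unif01"
  unfolding unif01_def by (rule prob_space_restrict_space) auto

lemma DERIV_dx:
  assumes "regular_S \<S>" "\<gamma> \<in> {0..1}" "k < 3"
  shows "((\<lambda>u. dx k \<S> u \<gamma>) has_real_derivative dx (Suc k) \<S> x \<gamma>) (at x)"
  using assms thrice_differentiable_derivs[of "\<lambda>u. \<S> u \<gamma>" k x]
  unfolding regular_S_def dx_def by blast

text \<open>
  Derivatives in the first argument are limits of difference quotients, hence jointly measurable.
\<close>

lemma measurable_dx:
  assumes meas: "(\<lambda>(x, \<gamma>). \<S> x \<gamma>) \<in> borel_measurable (borel \<Otimes>\<^sub>M restrict_space borel {0..1})"
    and reg: "regular_S \<S>" and "k \<le> 3"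
  shows "(\<lambda>z. dx k \<S> (fst z) (snd z)) \<in> borel_measurable (borel \<Otimes>\<^sub>M unif01)"
  using \<open>k \<le> 3\<close>
proof (induction k)
  case 0
  have "(\<lambda>(x, \<gamma>). \<S> x \<gamma>) \<in> borel_measurable (borel \<Otimes>\<^sub>M unif01)"
    using meas by (simp cong: measurable_cong_sets)
  then show ?case by (simp add: dx_def case_prod_beta)
next
  case (Suc k)
  then have [measurable]: "(\<lambda>z. dx k \<S> (fst z) (snd z)) \<in> borel_measurable (borel \<Otimes>\<^sub>M unif01)" by simp
  define e where "e n = 1 / real (Suc n)" for n
  have e: "filterlim e (at 0) sequentially"
    unfolding e_def filterlim_at using LIMSEQ_Suc[OF lim_1_over_n] by auto
  show ?case
  proof (rule borel_measurable_LIMSEQ_real)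
    fix z :: "real \<times> real" assume "z \<in> space (borel \<Otimes>\<^sub>M unif01)"
    then have "snd z \<in> {0..1}" by (auto simp: space_pair_measure)
    then have "((\<lambda>u. dx k \<S> u (snd z)) has_real_derivative dx (Suc k) \<S> (fst z) (snd z)) (at (fst z))"
      using Suc.prems by (intro DERIV_dx[OF reg]) auto
    then show "(\<lambda>n. (dx k \<S> (fst z + e n) (snd z) - dx k \<S> (fst z) (snd z)) / e n) \<longlonglongrightarrow> dx (Suc k) \<S> (fst z) (snd z)"
      unfolding DERIV_def by (rule filterlim_compose[OF _ e])
  next
    fix n
    have "(\<lambda>z. (fst z + e n, snd z)) \<in> borel \<Otimes>\<^sub>M unif01 \<rightarrow>\<^sub>M borel \<Otimes>\<^sub>M unif01" by measurable
    from measurable_compose[OF this, of "\<lambda>z. dx k \<S> (fst z) (snd z)"]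
    have [measurable]: "(\<lambda>z. dx k \<S> (fst z + e n) (snd z)) \<in> borel_measurable (borel \<Otimes>\<^sub>M unif01)" by simp
    show "(\<lambda>z. (dx k \<S> (fst z + e n) (snd z) - dx k \<S> (fst z) (snd z)) / e n) \<in> borel_measurable (borel \<Otimes>\<^sub>M unif01)"
      by measurable
  qed
qed

lemma dx_bounded:
  assumes "regular_S \<S>"
  shows "\<exists>K. \<forall>k\<in>{1..3}. \<forall>\<gamma>\<in>{0..1}. \<forall>x. \<bar>dx k \<S> x \<gamma>\<bar> \<le> K"
proof -
  have "\<exists>K. \<forall>x \<gamma>. \<gamma> \<in> {0..1} \<longrightarrow> \<bar>dx k \<S> x \<gamma>\<bar> \<le> K" if k: "k \<in> {1..3}" for k
  proof -
    have "bounded ((\<lambda>(x, \<gamma>). dx k \<S> x \<gamma>) ` (UNIV \<times> {0..1}))"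
      using assms k unfolding regular_S_def by blast
    then obtain K where "\<forall>y\<in>(\<lambda>(x, \<gamma>). dx k \<S> x \<gamma>) ` (UNIV \<times> {0..1}). norm y \<le> K"
      unfolding bounded_iff by blast
    then show ?thesis by (intro exI[of _ K]) force
  qed
  then have "\<forall>k\<in>{1..3}. \<exists>K. \<forall>x \<gamma>. \<gamma> \<in> {0..1} \<longrightarrow> \<bar>dx k \<S> x \<gamma>\<bar> \<le> K" by blast
  from bchoice[OF this] obtain K
    where K: "\<forall>k\<in>{1..3}. \<forall>x \<gamma>. \<gamma> \<in> {0..1} \<longrightarrow> \<bar>dx k \<S> x \<gamma>\<bar> \<le> K k" by blast
  have "\<bar>dx k \<S> x \<gamma>\<bar> \<le> Max (K ` {1..3})" if "k \<in> {1..3}" "\<gamma> \<in> {0..1}" for k x \<gamma>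
  proof (rule order.trans)
    show "\<bar>dx k \<S> x \<gamma>\<bar> \<le> K k" using K that by blast
    show "K k \<le> Max (K ` {1..3})" using that by (intro Max_ge) auto
  qed
  then show ?thesis by blast
qed

text \<open>
  Integration by parts in the first argument for each fixed value of the second one, and Fubini.
\<close>

lemma (in regular_target) integral_dxx:
  assumes meas: "(\<lambda>(x, \<gamma>). \<S> x \<gamma>) \<in> borel_measurable (borel \<Otimes>\<^sub>M restrict_space borel {0..1})"
    and reg: "regular_S \<S>"
  shows "(\<integral>z. dx 2 \<S> (fst z) (snd z) \<partial>(dens_law \<pi> \<Otimes>\<^sub>M unif01))
    = - (\<integral>z. score \<pi> (fst z) * dx 1 \<S> (fst z) (snd z) \<partial>(dens_law \<pi> \<Otimes>\<^sub>M unif01))"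
proof -
  interpret U: prob_space unif01 by (rule prob_space_unif01)
  interpret DU: pair_prob_space "dens_law \<pi>" unif01 ..
  obtain K where K: "\<And>k x \<gamma>. k \<in> {1..3} \<Longrightarrow> \<gamma> \<in> {0..1} \<Longrightarrow> \<bar>dx k \<S> x \<gamma>\<bar> \<le> K"
    using dx_bounded[OF reg] by blast
  have m [measurable]: "(\<lambda>z. dx 1 \<S> (fst z) (snd z)) \<in> borel_measurable (borel \<Otimes>\<^sub>M unif01)"
    "(\<lambda>z. dx 2 \<S> (fst z) (snd z)) \<in> borel_measurable (borel \<Otimes>\<^sub>M unif01)"
    by (rule measurable_dx[OF meas reg]; simp)+
  have score: "integrable (dens_law \<pi> \<Otimes>\<^sub>M unif01) (\<lambda>z. score \<pi> (fst z))"
    using integral_pair_fst(1)[OF prob_space_unif01, of "score \<pi>" "dens_law \<pi>"] integrable_score by simp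
  have int2: "integrable (dens_law \<pi> \<Otimes>\<^sub>M unif01) (\<lambda>z. dx 2 \<S> (fst z) (snd z))"
    by (rule DU.integrable_const_bound[of _ K]) (use K[of 2] in \<open>auto simp: space_pair_measure\<close>)
  have int1: "integrable (dens_law \<pi> \<Otimes>\<^sub>M unif01) (\<lambda>z. score \<pi> (fst z) * dx 1 \<S> (fst z) (snd z))"
  proof (rule Bochner_Integration.integrable_bound)
    show "integrable (dens_law \<pi> \<Otimes>\<^sub>M unif01) (\<lambda>z. K * \<bar>score \<pi> (fst z)\<bar>)" using score by simp
    show "AE z in dens_law \<pi> \<Otimes>\<^sub>M unif01. norm (score \<pi> (fst z) * dx 1 \<S> (fst z) (snd z)) \<le> norm (K * \<bar>score \<pi> (fst z)\<bar>)"
    proof (rule AE_I2)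
      fix z assume "z \<in> space (dens_law \<pi> \<Otimes>\<^sub>M unif01)"
      then have "\<bar>dx 1 \<S> (fst z) (snd z)\<bar> \<le> \<bar>K\<bar>"
        using K[of 1 "snd z" "fst z"] by (auto simp: space_pair_measure)
      from mult_left_mono[OF this abs_ge_zero[of "score \<pi> (fst z)"]]
      show "norm (score \<pi> (fst z) * dx 1 \<S> (fst z) (snd z)) \<le> norm (K * \<bar>score \<pi> (fst z)\<bar>)"
        by (simp add: abs_mult mult.commute)
    qed
  qed measurable
  let ?g = "\<lambda>x \<gamma>. dx 2 \<S> x \<gamma> + dx 1 \<S> x \<gamma> * score \<pi> x"
  have int: "integrable (dens_law \<pi> \<Otimes>\<^sub>M unif01) (case_prod ?g)"
    using Bochner_Integration.integrable_add[OF int2 int1] by (simp add: case_prod_unfold mult.commute)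
  have "(\<integral>\<gamma>. (\<integral>x. ?g x \<gamma> \<partial>dens_law \<pi>) \<partial>unif01) = 0"
  proof (subst Bochner_Integration.integral_cong[OF refl])
    fix \<gamma> assume "\<gamma> \<in> space unif01"
    then have \<gamma>: "\<gamma> \<in> {0..1}" by simp
    have mg [measurable]: "(\<lambda>x. dx 1 \<S> x \<gamma>) \<in> borel_measurable borel" "(\<lambda>x. dx 2 \<S> x \<gamma>) \<in> borel_measurable borel"
      using measurable_compose[OF measurable_Pair2'[of \<gamma> unif01 borel] m(1)]
        measurable_compose[OF measurable_Pair2'[of \<gamma> unif01 borel] m(2)] \<gamma> by simp_all
    have md: "(\<lambda>x. dx 1 \<S> x \<gamma>) \<in> borel_measurable (dens_law \<pi>)" "(\<lambda>x. dx 2 \<S> x \<gamma>) \<in> borel_measurable (dens_law \<pi>)"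
      by measurable
    have i1: "integrable (dens_law \<pi>) (\<lambda>x. dx 1 \<S> x \<gamma>)"
      by (rule integrable_const_bound[OF _ md(1), of K]) (use K[of 1] \<gamma> in simp)
    have i2: "integrable (dens_law \<pi>) (\<lambda>x. dx 2 \<S> x \<gamma>)"
      by (rule integrable_const_bound[OF _ md(2), of K]) (use K[of 2] \<gamma> in simp)
    have i3: "integrable (dens_law \<pi>) (\<lambda>x. dx 1 \<S> x \<gamma> * score \<pi> x)"
    proof (rule Bochner_Integration.integrable_bound)
      show "integrable (dens_law \<pi>) (\<lambda>x. K * \<bar>score \<pi> x\<bar>)" using integrable_score by simp
      have "\<bar>dx 1 \<S> x \<gamma>\<bar> * \<bar>score \<pi> x\<bar> \<le> \<bar>K\<bar> * \<bar>score \<pi> x\<bar>" for x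
        using K[of 1 \<gamma> x] \<gamma> by (intro mult_right_mono) auto
      then show "AE x in dens_law \<pi>. norm (dx 1 \<S> x \<gamma> * score \<pi> x) \<le> norm (K * \<bar>score \<pi> x\<bar>)"
        by (simp add: abs_mult)
    qed measurable
    have "((\<lambda>u. dx 1 \<S> u \<gamma>) has_real_derivative dx 2 \<S> x \<gamma>) (at x)" for x
      using DERIV_dx[OF reg \<gamma>, of 1 x] by (simp add: numeral_2_eq_2)
    then show "(\<integral>x. ?g x \<gamma> \<partial>dens_law \<pi>) = 0"
      by (rule stein_identity[OF _ i1 Bochner_Integration.integrable_add[OF i2 i3]])
  qed simp
  then have "(\<integral>z. case_prod ?g z \<partial>(dens_law \<pi> \<Otimes>\<^sub>M unif01)) = 0"
    using DU.integral_snd[OF int] by simp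
  then have "(\<integral>z. dx 2 \<S> (fst z) (snd z) + score \<pi> (fst z) * dx 1 \<S> (fst z) (snd z) \<partial>(dens_law \<pi> \<Otimes>\<^sub>M unif01)) = 0"
    by (simp add: case_prod_unfold mult.commute)
  then show ?thesis
    unfolding Bochner_Integration.integral_add[OF int2 int1] by linarith
qed

section \<open>Convergence for a fixed realisation\<close>

context regular_target
begin

lemma q_Delta_eq_sum: "q_Delta \<pi> d x y = (\<Sum>i<d. ln (\<pi> (y i)) - ln (\<pi> (x i)))"
proof -
  have ne: "\<pi> t \<noteq> 0" for t using pos[of t] by simp
  have "0 < prod_density \<pi> d z" "ln (prod_density \<pi> d z) = (\<Sum>i<d. ln (\<pi> (z i)))" for z
    unfolding prod_density_def by (auto intro!: prod_pos ln_prod simp: pos ne)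
  then show ?thesis by (simp add: q_Delta_def ln_divide_pos sum_subtractf)
qed

text \<open>
  The deterministic core: the randomness of \<open>x\<close> and \<open>\<gamma>\<close> enters through the limits of five averages.
\<close>

lemma quenched_limit:
  fixes \<S> :: "real \<Rightarrow> real \<Rightarrow> real" and x \<gamma> :: "nat \<Rightarrow> real" and \<mu> :: real
  assumes reg: "regular_S \<S>" and \<mu>: "0 < \<mu>" and \<gamma>: "\<And>i. \<gamma> i \<in> {0..1}"
    and score_sq: "(\<lambda>d. (\<Sum>i<d. (score \<pi> (x i))\<^sup>2) / real d) \<longlonglongrightarrow> (info \<pi>)\<^sup>2"
    and cross: "(\<lambda>d. (\<Sum>i<d. score \<pi> (x i) * dx 1 \<S> (x i) (\<gamma> i)) / real d) \<longlonglongrightarrow> c"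
    and dx_sq: "(\<lambda>d. (\<Sum>i<d. (dx 1 \<S> (x i) (\<gamma> i))\<^sup>2) / real d) \<longlonglongrightarrow> w"
    and curv: "(\<lambda>d. (\<Sum>i<d. (deriv ^^ 2) log_density (x i)) / real d) \<longlonglongrightarrow> \<kappa>"
    and dxx: "(\<lambda>d. (\<Sum>i<d. dx 2 \<S> (x i) (\<gamma> i)) / real d) \<longlonglongrightarrow> \<kappa>'"
  defines "\<tau> \<equiv> \<mu> / info \<pi>"
  assumes cs: "c\<^sup>2 \<le> (info \<pi>)\<^sup>2 * w"
  shows "converges_in_distribution std_normal_d
    (\<lambda>d z. vector [q_Delta \<pi> d x (proposal \<pi> \<mu> d x z), s_Delta \<S> \<gamma> d x (proposal \<pi> \<mu> d x z)])
    (normal_2 (vector [\<tau>\<^sup>2 / 2 * \<kappa>, \<tau>\<^sup>2 / 2 * \<kappa>']) (\<tau>\<^sup>2 * (info \<pi>)\<^sup>2) (\<tau>\<^sup>2 * c) (\<tau>\<^sup>2 * w))"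
    (is "converges_in_distribution _ ?V ?L")
proof -
  define m :: "real ^ 2" where "m = vector [\<tau>\<^sup>2 / 2 * \<kappa>, \<tau>\<^sup>2 / 2 * \<kappa>']"
  define a where "a d i = \<tau> / sqrt (real d) * score \<pi> (x i)" for d i
  define b where "b d i = \<tau> / sqrt (real d) * dx 1 \<S> (x i) (\<gamma> i)" for d i
  define U :: "nat \<Rightarrow> (nat \<Rightarrow> real) \<Rightarrow> real ^ 2"
    where "U d z = m + vector [\<Sum>i<d. a d i * z i, \<Sum>i<d. b d i * z i]" for d z
  have \<tau>: "0 < \<tau>" unfolding \<tau>_def using \<mu> info_pos by simp
  have pos_u: "0 < \<tau>\<^sup>2 * (info \<pi>)\<^sup>2" using \<tau> info_pos by simp
  have psd: "(\<tau>\<^sup>2 * c)\<^sup>2 \<le> \<tau>\<^sup>2 * (info \<pi>)\<^sup>2 * (\<tau>\<^sup>2 * w)"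
  proof -
    have "(\<tau>\<^sup>2 * \<tau>\<^sup>2) * c\<^sup>2 \<le> (\<tau>\<^sup>2 * \<tau>\<^sup>2) * ((info \<pi>)\<^sup>2 * w)"
      by (intro mult_left_mono cs) simp
    then show ?thesis by (simp add: power2_eq_square mult_ac)
  qed
  have scale: "(\<Sum>i<d. (\<tau> / sqrt (real d) * f i) * (\<tau> / sqrt (real d) * g i)) = \<tau>\<^sup>2 * ((\<Sum>i<d. f i * g i) / real d)"
    for d and f g :: "nat \<Rightarrow> real"
  proof -
    have "(\<tau> / sqrt (real d) * f i) * (\<tau> / sqrt (real d) * g i) = \<tau>\<^sup>2 / real d * (f i * g i)" for i
      by (simp add: power2_eq_square mult_ac)
    then show ?thesis by (simp only: sum_distrib_left[symmetric]) simp
  qed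
  have U: "converges_in_distribution std_normal_d U ?L"
    unfolding U_def m_def[symmetric]
  proof (rule linear_pair_converges_in_distribution[OF _ _ _ pos_u psd])
    show "(\<lambda>d. \<Sum>i<d. (a d i)\<^sup>2) \<longlonglongrightarrow> \<tau>\<^sup>2 * (info \<pi>)\<^sup>2"
      unfolding a_def power2_eq_square[of "_ / _ * _"] scale
      using tendsto_mult_left[OF score_sq, of "\<tau>\<^sup>2"] by (simp add: power2_eq_square)
    show "(\<lambda>d. \<Sum>i<d. a d i * b d i) \<longlonglongrightarrow> \<tau>\<^sup>2 * c"
      unfolding a_def b_def scale by (rule tendsto_mult_left[OF cross])
    show "(\<lambda>d. \<Sum>i<d. (b d i)\<^sup>2) \<longlonglongrightarrow> \<tau>\<^sup>2 * w"
      unfolding b_def power2_eq_square[of "_ / _ * _"] scale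
      using tendsto_mult_left[OF dx_sq, of "\<tau>\<^sup>2"] by (simp add: power2_eq_square)
  qed
  define R where "R d z = (\<Sum>i<d. log_density (x i + \<tau> / sqrt (real d) * z i) - log_density (x i))
      - (\<Sum>i<d. \<tau> / sqrt (real d) * deriv log_density (x i) * z i) - \<tau>\<^sup>2 / 2 * \<kappa>" for d z
  define R' where "R' d z = (\<Sum>i<d. \<S> (x i + \<tau> / sqrt (real d) * z i) (\<gamma> i) - \<S> (x i) (\<gamma> i))
      - (\<Sum>i<d. \<tau> / sqrt (real d) * deriv (\<lambda>u. \<S> u (\<gamma> i)) (x i) * z i) - \<tau>\<^sup>2 / 2 * \<kappa>'" for d z
  have R: "integrable (std_normal_d d) (R d)" "(\<lambda>d. \<integral>z. \<bar>R d z\<bar> \<partial>std_normal_d d) \<longlonglongrightarrow> 0" for d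
  proof -
    obtain K where K: "\<And>x. \<bar>(deriv ^^ 2) log_density x\<bar> \<le> K" "\<And>x. \<bar>(deriv ^^ 3) log_density x\<bar> \<le> K"
      using derivs_bounded by blast
    note * = quadratic_expansion_of_sum[where \<phi>="\<lambda>_. log_density" and x=x and \<tau>=\<tau>, OF diff3 K curv]
    show "integrable (std_normal_d d) (R d)" "(\<lambda>d. \<integral>z. \<bar>R d z\<bar> \<partial>std_normal_d d) \<longlonglongrightarrow> 0"
      unfolding R_def by (rule *)+
  qed
  have R': "integrable (std_normal_d d) (R' d)" "(\<lambda>d. \<integral>z. \<bar>R' d z\<bar> \<partial>std_normal_d d) \<longlonglongrightarrow> 0" for d
  proof -
    obtain K where K: "\<forall>k\<in>{1..3}. \<forall>\<gamma>\<in>{0..1}. \<forall>x. \<bar>dx k \<S> x \<gamma>\<bar> \<le> K"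
      using dx_bounded[OF reg] by blast
    have diff: "thrice_differentiable (\<lambda>u. \<S> u (\<gamma> i))" for i
      using reg \<gamma> unfolding regular_S_def by blast
    have K2: "\<bar>(deriv ^^ 2) (\<lambda>u. \<S> u (\<gamma> i)) x\<bar> \<le> K" for i x
      using bspec[OF bspec[OF K, of 2] \<gamma>] by (simp add: dx_def)
    have K3: "\<bar>(deriv ^^ 3) (\<lambda>u. \<S> u (\<gamma> i)) x\<bar> \<le> K" for i x
      using bspec[OF bspec[OF K, of 3] \<gamma>] by (simp add: dx_def)
    note * = quadratic_expansion_of_sum[where \<phi>="\<lambda>i u. \<S> u (\<gamma> i)" and x=x and \<tau>=\<tau>, OF diff K2 K3 dxx[unfolded dx_def]]
    show "integrable (std_normal_d d) (R' d)" "(\<lambda>d. \<integral>z. \<bar>R' d z\<bar> \<partial>std_normal_d d) \<longlonglongrightarrow> 0"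
      unfolding R'_def by (rule *)+
  qed
  have coord: "proposal \<pi> \<mu> d x z i = x i + \<tau> / sqrt (real d) * z i" for d z i
    by (simp add: proposal_def \<tau>_def)
  have q: "q_Delta \<pi> d x (proposal \<pi> \<mu> d x z) = R d z + (\<Sum>i<d. a d i * z i) + \<tau>\<^sup>2 / 2 * \<kappa>" for d z
    unfolding q_Delta_eq_sum coord R_def a_def score_def by simp
  have s: "s_Delta \<S> \<gamma> d x (proposal \<pi> \<mu> d x z) = R' d z + (\<Sum>i<d. b d i * z i) + \<tau>\<^sup>2 / 2 * \<kappa>'" for d z
    unfolding s_Delta_def sum_S_def coord R'_def b_def dx_def by (simp add: sum_subtractf)
  have V: "?V d z = U d z + vector [R d z, R' d z]" for d z
    unfolding q s U_def m_def by (simp add: vec_eq_iff forall_2)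
  have Rm: "(\<lambda>z. vector [R d z, R' d z] :: real ^ 2) \<in> borel_measurable (std_normal_d d)" for d
  proof -
    have "(\<lambda>z. (R d z, R' d z)) \<in> std_normal_d d \<rightarrow>\<^sub>M borel \<Otimes>\<^sub>M borel"
      using R(1)[of d] R'(1)[of d] by (intro measurable_Pair) auto
    from measurable_compose[OF this vector_2_measurable] show ?thesis by simp
  qed
  have norm_le: "norm (?V d z - U d z) \<le> \<bar>R d z\<bar> + \<bar>R' d z\<bar>" for d z
    unfolding V using norm_le_l1_cart[of "vector [R d z, R' d z] :: real ^ 2"] by (simp add: sum_2)
  have Um: "U d \<in> borel_measurable (std_normal_d d)" for d
    using U by (simp add: converges_in_distribution_def)
  have abs_int: "integrable (std_normal_d d) (\<lambda>z. \<bar>R d z\<bar> + \<bar>R' d z\<bar>)" for d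
    using R(1)[of d] R'(1)[of d] by (intro Bochner_Integration.integrable_add integrable_abs)
  have diff_int: "integrable (std_normal_d d) (\<lambda>z. norm (?V d z - U d z))" for d
  proof (rule Bochner_Integration.integrable_bound[OF abs_int])
    show "(\<lambda>z. norm (?V d z - U d z)) \<in> borel_measurable (std_normal_d d)"
      unfolding V using Rm[of d] by simp
    show "AE z in std_normal_d d. norm (norm (?V d z - U d z)) \<le> norm (\<bar>R d z\<bar> + \<bar>R' d z\<bar>)"
      using norm_le by (auto intro!: AE_I2)
  qed
  show ?thesis
  proof (rule converges_in_distribution_perturb[OF prob_space_std_normal_d U])
    show "prob_space ?L" by (rule prob_space_normal_2[OF pos_u psd])
    show "sets ?L = sets borel" by (rule sets_normal_2)
    show "?V d \<in> borel_measurable (std_normal_d d)" for d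
      unfolding V using Um Rm by (rule borel_measurable_add)
    show "integrable (std_normal_d d) (\<lambda>z. norm (?V d z - U d z))" for d by (rule diff_int)
    show "(\<lambda>d. \<integral>z. norm (?V d z - U d z) \<partial>std_normal_d d) \<longlonglongrightarrow> 0"
    proof (rule tendsto_sandwich[OF _ _ tendsto_const])
      show "\<forall>\<^sub>F d in sequentially. 0 \<le> (\<integral>z. norm (?V d z - U d z) \<partial>std_normal_d d)"
        by (intro always_eventually allI integral_nonneg_AE AE_I2) simp
      have "(\<integral>z. norm (?V d z - U d z) \<partial>std_normal_d d)
          \<le> (\<integral>z. \<bar>R d z\<bar> \<partial>std_normal_d d) + (\<integral>z. \<bar>R' d z\<bar> \<partial>std_normal_d d)" for d
        unfolding Bochner_Integration.integral_add[OF integrable_abs[OF R(1)] integrable_abs[OF R'(1)], symmetric]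
        by (intro integral_mono diff_int abs_int norm_le)
      then show "\<forall>\<^sub>F d in sequentially. (\<integral>z. norm (?V d z - U d z) \<partial>std_normal_d d)
          \<le> (\<integral>z. \<bar>R d z\<bar> \<partial>std_normal_d d) + (\<integral>z. \<bar>R' d z\<bar> \<partial>std_normal_d d)"
        by (intro always_eventually allI)
      show "(\<lambda>d. (\<integral>z. \<bar>R d z\<bar> \<partial>std_normal_d d) + (\<integral>z. \<bar>R' d z\<bar> \<partial>std_normal_d d)) \<longlonglongrightarrow> 0"
        using tendsto_add[OF R(2) R'(2)] by simp
    qed
  qed
qed

end

section \<open>The limit theorem\<close>

theorem lemma4p1:
  fixes \<pi> :: "real \<Rightarrow> real" and \<S> :: "real \<Rightarrow> real \<Rightarrow> real" and \<mu> :: real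
    and M :: "'a measure" and X \<Gamma> :: "nat \<Rightarrow> 'a \<Rightarrow> real"
  assumes "positive_prob_density \<pi>"
    and "(\<lambda>(x, \<gamma>). \<S> x \<gamma>) \<in> borel_measurable (borel \<Otimes>\<^sub>M restrict_space borel {0..1})"
    and "regular_density \<pi>"
    and "regular_S \<S>"
    and "\<mu> > 0"
    and "prob_space M"
    and "prob_space.indep_vars M (\<lambda>_. borel) X UNIV"
    and "\<And>i. distr M borel (X i) = dens_law \<pi>"
    and "prob_space.indep_vars M (\<lambda>_. unif01) \<Gamma> UNIV"
    and "\<And>i. distr M unif01 (\<Gamma> i) = unif01"
    and "prob_space.indep_var M (\<Pi>\<^sub>M i\<in>UNIV. borel) (\<lambda>\<omega> i. X i \<omega>)
           (\<Pi>\<^sub>M i\<in>UNIV. unif01) (\<lambda>\<omega> i. \<Gamma> i \<omega>)"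
  shows "\<exists>L :: (real ^ 2) measure.
    multivariate_normal
      ((- (\<mu>\<^sup>2 / 2)) *\<^sub>R vector [1, - beta1 \<pi> \<S>])
      (\<mu>\<^sup>2 *\<^sub>R vector [vector [1, - beta1 \<pi> \<S>], vector [- beta1 \<pi> \<S>, (beta2 \<pi> \<S>)\<^sup>2]]) L \<and>
    (AE \<omega> in M.
      converges_in_distribution std_normal_d
        (\<lambda>d z. let x = (\<lambda>i. X i \<omega>); \<gamma> = (\<lambda>i. \<Gamma> i \<omega>); x' = proposal \<pi> \<mu> d x z
               in vector [q_Delta \<pi> d x x', s_Delta \<S> \<gamma> d x x'])
        L)"
proof -
  interpret regular_target \<pi> by (rule regular_target.intro) (fact assms(1,3))+
  interpret U: prob_space unif01 by (rule prob_space_unif01)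
  interpret W: paired_sequences M borel unif01 "dens_law \<pi>" unif01 X \<Gamma>
    by (intro paired_sequences.intro paired_sequences_axioms.intro) (fact assms(6-11))+
  interpret DU: pair_prob_space "dens_law \<pi>" unif01 ..
  let ?D = "dens_law \<pi> \<Otimes>\<^sub>M unif01"
  define e where "e = (\<integral>z. dx 2 \<S> (fst z) (snd z) \<partial>?D)"
  define w where "w = (\<integral>z. (dx 1 \<S> (fst z) (snd z))\<^sup>2 \<partial>?D)"
  define \<tau> where "\<tau> = \<mu> / info \<pi>"
  have info: "info \<pi> \<noteq> 0" using info_pos by simp
  obtain K where K0: "\<forall>k\<in>{1..3}. \<forall>\<gamma>\<in>{0..1}. \<forall>x. \<bar>dx k \<S> x \<gamma>\<bar> \<le> K"
    using dx_bounded[OF assms(4)] by blast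
  have K: "\<bar>dx k \<S> (fst z) (snd z)\<bar> \<le> K" if "k \<in> {1, 2}" "z \<in> space ?D" for k z
    using bspec[OF bspec[OF K0, of k], of "snd z"] that by (auto simp: space_pair_measure)
  obtain K' where K': "\<And>x. \<bar>(deriv ^^ 2) log_density x\<bar> \<le> K'" using derivs_bounded by blast
  have meas: "(\<lambda>z. dx 1 \<S> (fst z) (snd z)) \<in> borel_measurable (borel \<Otimes>\<^sub>M unif01)"
    "(\<lambda>z. dx 2 \<S> (fst z) (snd z)) \<in> borel_measurable (borel \<Otimes>\<^sub>M unif01)"
    by (rule measurable_dx[OF assms(2,4)]; simp)+
  have meas_D: "f \<in> borel_measurable ?D" if "f \<in> borel_measurable (borel \<Otimes>\<^sub>M unif01)" for f :: "real \<times> real \<Rightarrow> real"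
    using that by (simp add: measurable_cong_sets[OF sets_pair_measure_cong[OF sets_dens_law refl] refl])
  have pow4: "integrable ?D (\<lambda>z. ((score \<pi> (fst z))\<^sup>2)\<^sup>2)"
    using integral_pair_fst(1)[OF prob_space_unif01, of "\<lambda>x. (score \<pi> x) ^ 4" "dens_law \<pi>"] integrable_score_pow4
    by (simp add: power_mult[symmetric])
  have sq: "integrable ?D (\<lambda>z. (score \<pi> (fst z))\<^sup>2)"
    using integral_pair_fst(1)[OF prob_space_unif01, of "\<lambda>x. (score \<pi> x)\<^sup>2" "dens_law \<pi>"] integrable_score_sq
    by simp
  have ae1: "AE \<omega> in M. (\<lambda>n. (\<Sum>i<n. (score \<pi> (X i \<omega>))\<^sup>2) / real n) \<longlonglongrightarrow> (info \<pi>)\<^sup>2"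
  proof -
    have "(\<integral>z. (score \<pi> (fst z))\<^sup>2 \<partial>?D) = (info \<pi>)\<^sup>2"
      using integral_pair_fst(2)[OF prob_space_unif01, of "\<lambda>x. (score \<pi> x)\<^sup>2" "dens_law \<pi>"]
      by (simp add: info_def)
    then show ?thesis
      using W.strong_law_pairs[of "\<lambda>z. (score \<pi> (fst z))\<^sup>2", OF _ pow4] by simp
  qed
  have ae2: "AE \<omega> in M. (\<lambda>n. (\<Sum>i<n. score \<pi> (X i \<omega>) * dx 1 \<S> (X i \<omega>) (\<Gamma> i \<omega>)) / real n) \<longlonglongrightarrow> - e"
  proof -
    let ?f = "\<lambda>z. score \<pi> (fst z) * dx 1 \<S> (fst z) (snd z)"
    have m: "?f \<in> borel_measurable (borel \<Otimes>\<^sub>M unif01)" using meas by measurable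
    have "integrable ?D (\<lambda>z. (?f z)\<^sup>2)"
    proof (rule Bochner_Integration.integrable_bound)
      show "integrable ?D (\<lambda>z. K\<^sup>2 * (score \<pi> (fst z))\<^sup>2)" using sq by simp
      show "(\<lambda>z. (?f z)\<^sup>2) \<in> borel_measurable ?D" using meas_D[OF m] by measurable
      show "AE z in ?D. norm ((?f z)\<^sup>2) \<le> norm (K\<^sup>2 * (score \<pi> (fst z))\<^sup>2)"
      proof (rule AE_I2)
        fix z assume "z \<in> space ?D"
        then have "(dx 1 \<S> (fst z) (snd z))\<^sup>2 \<le> K\<^sup>2"
          using K[of 1 z] by (simp add: abs_le_square_iff[symmetric])
        then show "norm ((?f z)\<^sup>2) \<le> norm (K\<^sup>2 * (score \<pi> (fst z))\<^sup>2)"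
          by (simp add: power_mult_distrib mult.commute[of "K\<^sup>2"] mult_left_mono)
      qed
    qed
    from W.strong_law_pairs[OF m this] show ?thesis
      using integral_dxx[OF assms(2,4)] by (simp add: e_def)
  qed
  have ae3: "AE \<omega> in M. (\<lambda>n. (\<Sum>i<n. (dx 1 \<S> (X i \<omega>) (\<Gamma> i \<omega>))\<^sup>2) / real n) \<longlonglongrightarrow> w"
  proof -
    have m: "(\<lambda>z. (dx 1 \<S> (fst z) (snd z))\<^sup>2) \<in> borel_measurable (borel \<Otimes>\<^sub>M unif01)" using meas by measurable
    have "integrable ?D (\<lambda>z. ((dx 1 \<S> (fst z) (snd z))\<^sup>2)\<^sup>2)"
    proof (rule DU.integrable_const_bound[of _ "K ^ 4"])
      show "AE z in ?D. norm (((dx 1 \<S> (fst z) (snd z))\<^sup>2)\<^sup>2) \<le> K ^ 4"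
      proof (rule AE_I2)
        fix z assume "z \<in> space ?D"
        then have "\<bar>dx 1 \<S> (fst z) (snd z)\<bar> ^ 4 \<le> K ^ 4" using K[of 1 z] by (intro power_mono) auto
        then show "norm (((dx 1 \<S> (fst z) (snd z))\<^sup>2)\<^sup>2) \<le> K ^ 4" by (simp add: power_mult[symmetric])
      qed
    qed (use meas_D[OF m] in measurable)
    from W.strong_law_pairs[OF m this] show ?thesis by (simp add: w_def)
  qed
  have ae4: "AE \<omega> in M. (\<lambda>n. (\<Sum>i<n. (deriv ^^ 2) log_density (X i \<omega>)) / real n) \<longlonglongrightarrow> - (info \<pi>)\<^sup>2"
  proof -
    have "integrable ?D (\<lambda>z. ((deriv ^^ 2) log_density (fst z))\<^sup>2)"
    proof (rule DU.integrable_const_bound[of _ "K'\<^sup>2"])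
      have "((deriv ^^ 2) log_density x)\<^sup>2 \<le> K'\<^sup>2" for x
        using power_mono[OF K'[of x] abs_ge_zero, of 2] by simp
      then show "AE z in ?D. norm (((deriv ^^ 2) log_density (fst z))\<^sup>2) \<le> K'\<^sup>2" by simp
    qed measurable
    from W.strong_law_pairs[OF _ this] show ?thesis
      using integral_pair_fst(2)[OF prob_space_unif01, of "(deriv ^^ 2) log_density" "dens_law \<pi>"]
        integral_deriv2_log_density by simp
  qed
  have ae5: "AE \<omega> in M. (\<lambda>n. (\<Sum>i<n. dx 2 \<S> (X i \<omega>) (\<Gamma> i \<omega>)) / real n) \<longlonglongrightarrow> e"
  proof -
    have "integrable ?D (\<lambda>z. (dx 2 \<S> (fst z) (snd z))\<^sup>2)"
    proof (rule DU.integrable_const_bound[of _ "K\<^sup>2"])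
      show "AE z in ?D. norm ((dx 2 \<S> (fst z) (snd z))\<^sup>2) \<le> K\<^sup>2"
      proof (rule AE_I2)
        fix z assume "z \<in> space ?D"
        then have "\<bar>dx 2 \<S> (fst z) (snd z)\<bar>\<^sup>2 \<le> K\<^sup>2" using K[of 2 z] by (intro power_mono) auto
        then show "norm ((dx 2 \<S> (fst z) (snd z))\<^sup>2) \<le> K\<^sup>2" by simp
      qed
    qed (use meas_D[OF meas(2)] in measurable)
    from W.strong_law_pairs[OF meas(2) this] show ?thesis by (simp add: e_def)
  qed
  \<comment> \<open>The Cauchy-Schwarz inequality for the limits is read off from the one for finite averages
    along a single realisation.\<close>
  have cs: "(- e)\<^sup>2 \<le> (info \<pi>)\<^sup>2 * w"
  proof -
    have "AE \<omega> in M. (- e)\<^sup>2 \<le> (info \<pi>)\<^sup>2 * w"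
      using ae1 ae2 ae3
    proof eventually_elim
      case (elim \<omega>)
      let ?s = "\<lambda>i. score \<pi> (X i \<omega>)" and ?d = "\<lambda>i. dx 1 \<S> (X i \<omega>) (\<Gamma> i \<omega>)"
      show ?case
      proof (rule LIMSEQ_le[OF tendsto_power[OF elim(2)] tendsto_mult[OF elim(1,3)]], intro exI allI impI)
        fix n
        have "(\<Sum>i<n. ?s i * ?d i)\<^sup>2 / (real n)\<^sup>2 \<le> (\<Sum>i<n. (?s i)\<^sup>2) * (\<Sum>i<n. (?d i)\<^sup>2) / (real n)\<^sup>2"
          by (intro divide_right_mono Cauchy_Schwarz_ineq_sum) simp
        then show "((\<Sum>i<n. ?s i * ?d i) / real n)\<^sup>2
            \<le> (\<Sum>i<n. (?s i)\<^sup>2) / real n * ((\<Sum>i<n. (?d i)\<^sup>2) / real n)"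
          by (simp add: power_divide power2_eq_square)
      qed
    qed
    then show ?thesis by simp
  qed
  have w0: "0 \<le> w" by (simp add: w_def)
  have \<tau>: "0 < \<tau>" unfolding \<tau>_def using assms(5) info_pos by simp
  have \<mu>: "\<mu>\<^sup>2 = \<tau>\<^sup>2 * (info \<pi>)\<^sup>2" using info by (simp add: \<tau>_def power_divide)
  have beta1: "beta1 \<pi> \<S> = e / (info \<pi>)\<^sup>2" by (simp add: beta1_def e_def case_prod_unfold)
  have beta2: "(beta2 \<pi> \<S>)\<^sup>2 = w / (info \<pi>)\<^sup>2"
  proof -
    have "beta2 \<pi> \<S> = sqrt (w / (info \<pi>)\<^sup>2)" by (simp add: beta2_def w_def case_prod_unfold)
    then show ?thesis using w0 by simp
  qed
  define m :: "real ^ 2" where "m = vector [\<tau>\<^sup>2 / 2 * (- (info \<pi>)\<^sup>2), \<tau>\<^sup>2 / 2 * e]"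
  have m: "(- (\<mu>\<^sup>2 / 2)) *\<^sub>R vector [1, - beta1 \<pi> \<S>] = m"
    unfolding m_def \<mu> beta1 using info by (simp add: vec_eq_iff forall_2)
  have V: "\<mu>\<^sup>2 *\<^sub>R vector [vector [1, - beta1 \<pi> \<S>], vector [- beta1 \<pi> \<S>, (beta2 \<pi> \<S>)\<^sup>2]]
      = (vector [vector [\<tau>\<^sup>2 * (info \<pi>)\<^sup>2, \<tau>\<^sup>2 * (- e)], vector [\<tau>\<^sup>2 * (- e), \<tau>\<^sup>2 * w]] :: real ^ 2 ^ 2)"
    unfolding \<mu> beta1 beta2 using info by (simp add: vec_eq_iff forall_2)
  have u: "0 < \<tau>\<^sup>2 * (info \<pi>)\<^sup>2" using \<tau> info by simp
  have psd: "(\<tau>\<^sup>2 * (- e))\<^sup>2 \<le> \<tau>\<^sup>2 * (info \<pi>)\<^sup>2 * (\<tau>\<^sup>2 * w)"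
  proof -
    have "(\<tau>\<^sup>2 * \<tau>\<^sup>2) * (- e)\<^sup>2 \<le> (\<tau>\<^sup>2 * \<tau>\<^sup>2) * ((info \<pi>)\<^sup>2 * w)"
      by (intro mult_left_mono cs) simp
    then show ?thesis by (simp add: power2_eq_square mult_ac)
  qed
  have "AE \<omega> in M. \<forall>i. \<Gamma> i \<omega> \<in> {0..1}"
  proof (rule AE_I2)
    fix \<omega> assume "\<omega> \<in> space M"
    then have "\<Gamma> i \<omega> \<in> space unif01" for i by (rule measurable_space[OF W.\<Gamma>_measurable])
    then show "\<forall>i. \<Gamma> i \<omega> \<in> {0..1}" by simp
  qed
  then have conv: "AE \<omega> in M. converges_in_distribution std_normal_d
      (\<lambda>d z. let x = (\<lambda>i. X i \<omega>); \<gamma> = (\<lambda>i. \<Gamma> i \<omega>); x' = proposal \<pi> \<mu> d x z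
        in vector [q_Delta \<pi> d x x', s_Delta \<S> \<gamma> d x x'])
      (normal_2 m (\<tau>\<^sup>2 * (info \<pi>)\<^sup>2) (\<tau>\<^sup>2 * (- e)) (\<tau>\<^sup>2 * w))"
    using ae1 ae2 ae3 ae4 ae5
  proof eventually_elim
    case (elim \<omega>)
    show ?case
      unfolding Let_def m_def \<tau>_def
      by (rule quenched_limit[OF assms(4,5) _ elim(2-6) cs]) (use elim(1) in blast)
  qed
  show ?thesis
    unfolding m V using multivariate_normal_normal_2[OF u psd] conv by blast
qed

end
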